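(* Assume there exists a feasible point $M=(M_0,\dots,M_{T-1})$ of the problem (P) described in the context such that $(M_t)_{ij}>0$ whenever $(A_t)_{ij}>0$ (for all $t,i,j$). For $\lambda_t\in\mathbb{R}^k$, $t=0,\dots,T$, put $u_t:=\exp(C^\top\lambda_t)\in\mathbb{R}^n_{>0}$ (entrywise exponential). Then a (Lagrangian) dual formulation of (P) is $$\max_{\lambda_0,\dots,\lambda_T\in\mathbb{R}^k}\ \sum_{t=0}^{T}\lambda_t^\top\rho_t\quad\text{subject to}\quad \operatorname{diag}(u_0)A_0\operatorname{diag}(u_1)A_1\cdots \operatorname{diag}(u_{T-1})A_{T-1}u_T\le \mathbf 1,\qquad (\mathrm D)$$ that is, for each $\lambda=(\lambda_0,\dots,\lambda_T)$, the quantity $\sup_{\nu}\inf_{M}\mathcal L(M,\lambda,\nu)$ (with $\mathcal L$ the Lagrangian in the context) equals $\sum_{t=0}^T\lambda_t^\top\rho_t$ if $\lambda$ satisfies the constraint of (D), and $-\infty$ otherwise. Moreover, the maximum in (D) is attained, and for any maximizer $\lambda$ of (D) there exist vectors $w_1,\dots,w_{T-1}\in\mathbb{R}^n_{>0}$ such that, with $w_0:=\mathbf 1$ and $w_T:=u_T$, every optimal solution $M^*$ of (P) satisfies, for all $t=0,\dots,T-1$, $$M_t^*=\operatorname{diag}(M_t^*\mathbf 1)\,\operatorname{diag}(u_t\oslash w_t)\,A_t\,\operatorname{diag}(w_{t+1}).$$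
   Context: Setting. Let $n,T\ge1$ be integers and let $A_0,\dots,A_{T-1}\in\mathbb{R}^{n\times n}_{\ge0}$ be row-stochastic matrices ($A_t\mathbf 1=\mathbf 1$). Let $\pi=\{\pi_1,\dots,\pi_k\}\subseteq\{1,\dots,n\}$ have $k$ elements and let $C=[e_{\pi_1},\dots,e_{\pi_k}]^\top\in\{0,1\}^{k\times n}$ be the coordinate-selection matrix of $\pi$ ($e_i$ the standard basis vectors). Let $\rho_0,\dots,\rho_T\in\mathbb{R}^k$ be given. Notation. $\mathbf 1$ is the all-ones vector; $\odot,\oslash,\exp$ are entrywise multiplication, division, exponential; inequalities between vectors are entrywise; $\operatorname{supp}$ of a vector or matrix is the set of positions of its nonzero entries. For nonnegative arrays $p,q$ of the same size with $\operatorname{supp}(p)\subseteq\operatorname{supp}(q)$, the normalized Kullback–Leibler divergence is $\mathcal D(p\,|\,q)=\sum_i\big(p_i\log(p_i/q_i)-p_i+q_i\big)$, with $0\log 0:=0$ (terms with $p_i=q_i=0$ are $0$). Problem (P): minimize $\sum_{t=0}^{T-1}\mathcal D\big(M_t\,|\,\operatorname{diag}(M_t\mathbf 1)A_t\big)$ over $M_0,\dots,M_{T-1}\in\mathbb{R}^{n\times n}_{\ge0}$ with $\operatorname{supp}(M_t)\subseteq\operatorname{supp}(A_t)$, subject to (i) $CM_t\mathbf 1=\rho_t$ for $t=0,\dots,T-1$; (ii) $CM_{T-1}^\top\mathbf 1=\rho_T$; (iii) $M_t\mathbf 1=M_{t-1}^\top\mathbf 1$ for $t=1,\dots,T-1$.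 Lagrangian: for multipliers $\lambda_t\in\mathbb{R}^k$ ($0\le t\le T$) and $\nu_t\in\mathbb{R}^n$ ($1\le t\le T-1$), $$\mathcal L(M,\lambda,\nu)=\sum_{t=0}^{T-1}\mathcal D(M_t|\operatorname{diag}(M_t\mathbf 1)A_t)+\sum_{t=0}^{T-1}\lambda_t^\top(\rho_t-CM_t\mathbf 1)+\lambda_T^\top(\rho_T-CM_{T-1}^\top\mathbf 1)+\sum_{t=1}^{T-1}\nu_t^\top(M_t\mathbf 1-M_{t-1}^\top\mathbf 1),$$ and $\inf_M$ is over all $M_t\in\mathbb{R}^{n\times n}_{\ge0}$ with $\operatorname{supp}(M_t)\subseteq\operatorname{supp}(A_t)$. *)

theory Defs
  imports Complex_Main "HOL-Library.Extended_Real" "HOL-Library.FuncSet"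
    "Jordan_Normal_Form.Matrix"
begin

text \<open>
  Coordinates are numbered from 0: the index set \<open>{1,...,n}\<close> becomes \<open>{..<n}\<close>. Families such as
  \<open>M\<^sub>0, ..., M\<^sub>T\<^sub>-\<^sub>1\<close> are functions on \<open>nat\<close> whose values outside the stated range of \<open>t\<close> are
  irrelevant.
\<close>

definition ones_vec :: "nat \<Rightarrow> real vec" where
  "ones_vec n = vec n (\<lambda>_. 1)"

definition diag :: "real vec \<Rightarrow> real mat" where
  "diag v = mat_diag (dim_vec v) (\<lambda>i. v $ i)"

definition divide_vec :: "real vec \<Rightarrow> real vec \<Rightarrow> real vec"  (infixl \<open>\<oslash>\<close> 70) where
  "v \<oslash> w = vec (dim_vec v) (\<lambda>i. v $ i / w $ i)"

definition supp_mat :: "real mat \<Rightarrow> (nat \<times> nat) set" where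
  "supp_mat P = {(i, j). i < dim_row P \<and> j < dim_col P \<and> P $$ (i, j) \<noteq> 0}"

definition row_stochastic :: "nat \<Rightarrow> real mat \<Rightarrow> bool" where
  "row_stochastic n P \<longleftrightarrow>
     P \<in> carrier_mat n n \<and> 0\<^sub>m n n \<le> P \<and> P *\<^sub>v ones_vec n = ones_vec n"

text \<open>
  Only meaningful for nonnegative \<open>P\<close>, \<open>Q\<close> of the same size with \<open>supp_mat P \<subseteq> supp_mat Q\<close>;
  then \<open>0 * ln (0 / q) = 0\<close> implements the convention \<open>0 log 0 = 0\<close>, also for \<open>q = 0\<close>.
\<close>
definition kl_div :: "real mat \<Rightarrow> real mat \<Rightarrow> real" where
  "kl_div P Q = (\<Sum>i<dim_row P. \<Sum>j<dim_col P.
     P $$ (i, j) * ln (P $$ (i, j) / Q $$ (i, j)) - P $$ (i, j) + Q $$ (i, j))"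

text \<open>The \<open>k \<times> n\<close> matrix with rows \<open>e\<^sub>\<pi>\<^sub>1, ..., e\<^sub>\<pi>\<^sub>k\<close>, where \<open>k = length \<pi>\<close>.\<close>
definition selection_mat :: "nat \<Rightarrow> nat list \<Rightarrow> real mat" where
  "selection_mat n \<pi> = mat_of_rows n (map (unit_vec n) \<pi>)"

definition primal_domain :: "nat \<Rightarrow> nat \<Rightarrow> (nat \<Rightarrow> real mat) \<Rightarrow> (nat \<Rightarrow> real mat) set" where
  "primal_domain n T A = {M. \<forall>t<T. M t \<in> carrier_mat n n \<and> 0\<^sub>m n n \<le> M t \<and>
     supp_mat (M t) \<subseteq> supp_mat (A t)}"

definition primal_objective :: "nat \<Rightarrow> nat \<Rightarrow> (nat \<Rightarrow> real mat) \<Rightarrow> (nat \<Rightarrow> real mat) \<Rightarrow> real" where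
  "primal_objective n T A M = (\<Sum>t<T. kl_div (M t) (diag (M t *\<^sub>v ones_vec n) * A t))"

definition primal_feasible ::
  "nat \<Rightarrow> nat \<Rightarrow> (nat \<Rightarrow> real mat) \<Rightarrow> real mat \<Rightarrow> (nat \<Rightarrow> real vec) \<Rightarrow> (nat \<Rightarrow> real mat) \<Rightarrow> bool" where
  "primal_feasible n T A C \<rho> M \<longleftrightarrow>
     M \<in> primal_domain n T A \<and>
     (\<forall>t<T. C *\<^sub>v (M t *\<^sub>v ones_vec n) = \<rho> t) \<and>
     C *\<^sub>v ((M (T - 1))\<^sup>T *\<^sub>v ones_vec n) = \<rho> T \<and>
     (\<forall>t\<in>{1..<T}. M t *\<^sub>v ones_vec n = (M (t - 1))\<^sup>T *\<^sub>v ones_vec n)"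

definition primal_optimal ::
  "nat \<Rightarrow> nat \<Rightarrow> (nat \<Rightarrow> real mat) \<Rightarrow> real mat \<Rightarrow> (nat \<Rightarrow> real vec) \<Rightarrow> (nat \<Rightarrow> real mat) \<Rightarrow> bool" where
  "primal_optimal n T A C \<rho> M \<longleftrightarrow>
     is_arg_min (primal_objective n T A) (primal_feasible n T A C \<rho>) M"

definition lagrangian ::
  "nat \<Rightarrow> nat \<Rightarrow> (nat \<Rightarrow> real mat) \<Rightarrow> real mat \<Rightarrow> (nat \<Rightarrow> real vec) \<Rightarrow>
   (nat \<Rightarrow> real mat) \<Rightarrow> (nat \<Rightarrow> real vec) \<Rightarrow> (nat \<Rightarrow> real vec) \<Rightarrow> real" where
  "lagrangian n T A C \<rho> M lam \<nu> =
     primal_objective n T A M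
     + (\<Sum>t<T. lam t \<bullet> (\<rho> t - C *\<^sub>v (M t *\<^sub>v ones_vec n)))
     + lam T \<bullet> (\<rho> T - C *\<^sub>v ((M (T - 1))\<^sup>T *\<^sub>v ones_vec n))
     + (\<Sum>t\<in>{1..<T}. \<nu> t \<bullet> (M t *\<^sub>v ones_vec n - (M (t - 1))\<^sup>T *\<^sub>v ones_vec n))"

definition scaling :: "real mat \<Rightarrow> (nat \<Rightarrow> real vec) \<Rightarrow> nat \<Rightarrow> real vec" where
  "scaling C lam t = map_vec exp (C\<^sup>T *\<^sub>v lam t)"

text \<open>The product \<open>diag u\<^sub>0 A\<^sub>0 diag u\<^sub>1 A\<^sub>1 ... diag u\<^sub>T\<^sub>-\<^sub>1 A\<^sub>T\<^sub>-\<^sub>1 u\<^sub>T\<close>, bracketed to the right.\<close>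
definition scaled_product :: "nat \<Rightarrow> (nat \<Rightarrow> real mat) \<Rightarrow> (nat \<Rightarrow> real vec) \<Rightarrow> real vec" where
  "scaled_product T A u = foldr (\<lambda>t v. diag (u t) *\<^sub>v (A t *\<^sub>v v)) [0..<T] (u T)"

definition dual_constraint ::
  "nat \<Rightarrow> nat \<Rightarrow> (nat \<Rightarrow> real mat) \<Rightarrow> real mat \<Rightarrow> (nat \<Rightarrow> real vec) \<Rightarrow> bool" where
  "dual_constraint n T A C lam \<longleftrightarrow> scaled_product T A (scaling C lam) \<le> ones_vec n"

definition dual_objective :: "nat \<Rightarrow> (nat \<Rightarrow> real vec) \<Rightarrow> (nat \<Rightarrow> real vec) \<Rightarrow> real" where
  "dual_objective T \<rho> lam = (\<Sum>t\<le>T. lam t \<bullet> \<rho> t)"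

definition dual_optimal ::
  "nat \<Rightarrow> nat \<Rightarrow> nat \<Rightarrow> (nat \<Rightarrow> real mat) \<Rightarrow> real mat \<Rightarrow> (nat \<Rightarrow> real vec) \<Rightarrow>
   (nat \<Rightarrow> real vec) \<Rightarrow> bool" where
  "dual_optimal n k T A C \<rho> lam \<longleftrightarrow>
     is_arg_max (dual_objective T \<rho>)
       (\<lambda>lam. lam \<in> {..T} \<rightarrow> carrier_vec k \<and> dual_constraint n T A C lam) lam"

end

theory Submission
  imports Defs
begin

text \<open>
  Put \<open>w\<^sub>t = exp \<nu>\<^sub>t\<close> with \<open>w\<^sub>0 = 1\<close>, \<open>w\<^sub>T = u\<^sub>T\<close>, and \<open>Q\<^sub>t = diag (u\<^sub>t / w\<^sub>t) A\<^sub>t diag w\<^sub>t\<^sub>+\<^sub>1\<close>. Since the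
  rows of \<open>A\<^sub>t\<close> sum to 1, the Lagrangian equals \<open>\<Sum>\<^sub>t \<lambda>\<^sub>t \<bullet> \<rho>\<^sub>t\<close> plus the sum of \<open>M log (M / (r Q))\<close> over
  all entries, where \<open>r\<close> is the row sum of \<open>M\<close>. This excess is positively homogeneous in every row,
  and by Gibbs' inequality it is bounded below iff the rows of all \<open>Q\<^sub>t\<close> have mass at most 1; then
  it is nonnegative and vanishes only for \<open>M = r Q\<close>. The smallest admissible \<open>w\<close> is the backward
  recursion \<open>w\<^sub>t = diag u\<^sub>t A\<^sub>t w\<^sub>t\<^sub>+\<^sub>1\<close>, for which the condition at \<open>t = 0\<close> is the constraint of (D).

  For attainment and strong duality, the exponents \<open>s = \<mu>\<^sub>t\<^sub>,\<^sub>i - \<nu>\<^sub>t\<^sub>,\<^sub>i + \<nu>\<^sub>t\<^sub>+\<^sub>1\<^sub>,\<^sub>j\<close>, \<open>\<mu>\<^sub>t = C\<^sup>T \<lambda>\<^sub>t\<close>, range over a linear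
  subspace of the functions on the support of \<open>A\<close>, on which the dual objective is the pairing with
  the given positive feasible point. Row masses at most 1 bound \<open>s\<close> above, positivity of that point
  then bounds it below. Maximizing the objective with a logarithmic barrier of weight \<open>\<delta>\<close> produces
  primal feasible points with duality gap \<open>O(\<delta>)\<close>; a limit of the maximizers as \<open>\<delta> \<rightarrow> 0\<close> solves (D).
\<close>

subsection \<open>Subspaces of functions on a finite set\<close>

text \<open>Bolzano-Weierstrass, one coordinate at a time: a bounded sequence has a monotone, hence
  convergent, subsequence, and thinning further keeps the limits already obtained.\<close>

lemma finite_convergent_subsequence:
  fixes X :: "nat \<Rightarrow> 'e \<Rightarrow> real"
  assumes "finite E" and "\<And>e N. e \<in> E \<Longrightarrow> \<bar>X N e\<bar> \<le> K e"
  shows "\<exists>r l. strict_mono (r :: nat \<Rightarrow> nat) \<and> (\<forall>e\<in>E. (\<lambda>N. X (r N) e) \<longlonglongrightarrow> l e)"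
  using assms
proof (induction E rule: finite_induct)
  case empty
  show ?case by (rule exI[of _ id]) (auto simp: strict_mono_def)
next
  case (insert e E)
  then obtain r l where r: "strict_mono (r :: nat \<Rightarrow> nat)"
    and l: "\<And>e'. e' \<in> E \<Longrightarrow> (\<lambda>N. X (r N) e') \<longlonglongrightarrow> l e'" by blast
  obtain q where q: "strict_mono (q :: nat \<Rightarrow> nat)" and mono: "monoseq (\<lambda>N. X (r (q N)) e)"
    using seq_monosub[of "\<lambda>N. X (r N) e"] by auto
  have "Bseq (\<lambda>N. X (r (q N)) e)"
    by (rule BseqI'[of _ "K e"]) (use insert.prems in auto)
  then obtain x where x: "(\<lambda>N. X (r (q N)) e) \<longlonglongrightarrow> x"
    using mono Bseq_monoseq_convergent convergent_def by blast
  have "(\<lambda>N. X ((r \<circ> q) N) e') \<longlonglongrightarrow> (l(e := x)) e'" if "e' \<in> insert e E" for e'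
    using that x LIMSEQ_subseq_LIMSEQ[OF l q] by (auto simp: o_def)
  then show ?case using strict_mono_o[OF r q] by blast
qed

text \<open>Extreme value theorem without a topology on the domain: only the values of
  \<open>f\<close> have to converge, to the value at some point of \<open>D\<close>. This suits
  functions whose limits are controlled on a finite set only.\<close>

lemma seq_compact_attains_max:
  fixes f :: "'a \<Rightarrow> real"
  assumes "x0 \<in> D"
    and seq: "\<And>X. (\<And>N. X N \<in> D) \<Longrightarrow>
      \<exists>r l. strict_mono (r :: nat \<Rightarrow> nat) \<and> l \<in> D \<and> (\<lambda>N. f (X (r N))) \<longlonglongrightarrow> f l"
  shows "\<exists>s\<in>D. \<forall>x\<in>D. f x \<le> f s"
proof -
  \<comment> \<open>Points with \<open>f (X N) > N\<close> would have a subsequence whose values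
    both converge and tend to infinity.\<close>
  have bdd: "bdd_above (f ` D)"
  proof (rule ccontr)
    assume "\<not> bdd_above (f ` D)"
    then have "\<exists>x\<in>D. f x > real N" for N
      by (meson bdd_above.I2 not_le)
    then obtain X where X: "\<And>N. X N \<in> D" "\<And>N. f (X N) > real N" by metis
    then obtain r l where r: "strict_mono (r :: nat \<Rightarrow> nat)"
      and l: "(\<lambda>N. f (X (r N))) \<longlonglongrightarrow> f l" using seq by blast
    have "filterlim (\<lambda>N. f (X (r N))) at_top sequentially"
    proof (rule filterlim_at_top_mono[OF filterlim_real_sequentially], rule always_eventually, rule allI)
      fix N
      have "real N \<le> real (r N)" using seq_suble[OF r, of N] by simp
      then show "real N \<le> f (X (r N))" using X(2)[of "r N"] by linarith
    qed
    then show False using l not_tendsto_and_filterlim_at_infinity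
        filterlim_at_top_imp_at_infinity sequentially_bot by blast
  qed
  define S where "S = Sup (f ` D)"
  have le: "f x \<le> S" if "x \<in> D" for x
    unfolding S_def using bdd that by (simp add: cSUP_upper)
  have "\<exists>x\<in>D. f x > S - 1 / Suc N" for N
    using less_cSupD[of "f ` D" "S - 1 / Suc N"] assms(1) unfolding S_def by auto
  then obtain X where X: "\<And>N. X N \<in> D" "\<And>N. f (X N) > S - 1 / Suc N" by metis
  then obtain r l where r: "strict_mono (r :: nat \<Rightarrow> nat)" and lD: "l \<in> D"
    and l: "(\<lambda>N. f (X (r N))) \<longlonglongrightarrow> f l" using seq by blast
  have "(\<lambda>N. S - 1 / Suc N) \<longlonglongrightarrow> S - 0"
    by (intro tendsto_intros LIMSEQ_Suc[OF lim_1_over_n])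
  then have "(\<lambda>N. S - 1 / Suc (r N)) \<longlonglongrightarrow> S"
    using LIMSEQ_subseq_LIMSEQ[OF _ r] by (fastforce simp: o_def)
  then have "S \<le> f l"
    by (rule LIMSEQ_le[OF _ l]) (use X(2) less_imp_le in blast)
  then show ?thesis using lD le by (meson order_trans)
qed

definition pointwise_subspace :: "('e \<Rightarrow> real) set \<Rightarrow> bool" where
  "pointwise_subspace V \<longleftrightarrow> (\<lambda>_. 0) \<in> V \<and> (\<forall>v\<in>V. \<forall>w\<in>V. (\<lambda>e. v e + w e) \<in> V) \<and>
     (\<forall>c. \<forall>v\<in>V. (\<lambda>e. c * v e) \<in> V)"

lemma pointwise_subspace_add_scaled:
  assumes "pointwise_subspace V" and "v \<in> V" and "w \<in> V"
  shows "(\<lambda>e. v e + c * w e) \<in> V"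
proof -
  have "(\<lambda>e. c * w e) \<in> V" using assms unfolding pointwise_subspace_def by blast
  then show ?thesis
    using assms(1,2) bspec[of V "\<lambda>w. (\<lambda>e. v e + w e) \<in> V" "\<lambda>e. c * w e"]
    unfolding pointwise_subspace_def by blast
qed

text \<open>Membership up to values outside the finite set \<open>E\<close>. This is what makes \<open>V\<close> closed under
  pointwise limits on \<open>E\<close>.\<close>
lemma mem_biannihilator:
  assumes "finite E" and "pointwise_subspace V"
    and "\<And>b. (\<forall>v\<in>V. (\<Sum>e\<in>E. b e * v e) = 0) \<Longrightarrow> (\<Sum>e\<in>E. b e * s e) = 0"
  shows "\<exists>v\<in>V. \<forall>e\<in>E. v e = s e"
  using assms
proof (induction E arbitrary: V s rule: finite_induct)
  case empty
  then show ?case by (auto simp: pointwise_subspace_def)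
next
  case (insert e E)
  note V = insert.prems(1)[unfolded pointwise_subspace_def]
  show ?case
  proof (cases "\<forall>v\<in>V. v e = 0")
    \<comment> \<open>Functionals on \<open>E\<close> extend by 0 at \<open>e\<close>, so the
      induction hypothesis applies to \<open>V\<close> itself. The indicator of \<open>e\<close>
      annihilates \<open>V\<close>, which forces \<open>s e = 0\<close>.\<close>
    case True
    have "\<exists>v\<in>V. \<forall>e'\<in>E. v e' = s e'"
    proof (rule insert.IH[OF insert.prems(1)])
      fix b assume b: "\<forall>v\<in>V. (\<Sum>e\<in>E. b e * v e) = 0"
      have upd: "(\<Sum>e'\<in>E. (b(e := 0)) e' * f e') = (\<Sum>e'\<in>E. b e' * f e')" for f
        using insert.hyps by (intro sum.cong) auto
      have "(\<Sum>e'\<in>insert e E. (b(e := 0)) e' * s e') = 0"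
        by (rule insert.prems(2)) (use insert.hyps b upd in simp)
      then show "(\<Sum>e\<in>E. b e * s e) = 0" using insert.hyps upd by simp
    qed
    moreover have "s e = 0"
    proof -
      have ind: "(\<Sum>e'\<in>E. (if e' = e then 1 else 0) * f e') = 0" for f :: "_ \<Rightarrow> real"
        using insert.hyps by (intro sum.neutral) auto
      have "(\<Sum>e'\<in>insert e E. (if e' = e then 1 else 0) * s e') = 0"
        by (rule insert.prems(2)) (use insert.hyps True ind in simp)
      then show ?thesis using insert.hyps ind by simp
    qed
    ultimately show ?thesis using True by auto
  next
    case False
    then obtain v0 where v0: "v0 \<in> V" "v0 e \<noteq> 0" by blast
    \<comment> \<open>Normalized to 1 at \<open>e\<close>: subtracting \<open>s e * v1\<close> from
      \<open>s\<close> reduces the claim to the members of \<open>V\<close> that vanish at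
      \<open>e\<close>; adding it back finishes.\<close>
    define v1 where "v1 = (\<lambda>e'. (1 / v0 e) * v0 e')"
    have v1: "v1 \<in> V" "v1 e = 1" unfolding v1_def using v0 V by (blast, simp_all)
    have "pointwise_subspace {v\<in>V. v e = 0}"
      using V unfolding pointwise_subspace_def by simp
    then have "\<exists>v\<in>{v\<in>V. v e = 0}. \<forall>e'\<in>E. v e' = s e' - s e * v1 e'"
    proof (rule insert.IH)
      fix b assume b: "\<forall>v\<in>{v\<in>V. v e = 0}. (\<Sum>e\<in>E. b e * v e) = 0"
      \<comment> \<open>The coefficient \<open>- c\<close> at \<open>e\<close> makes the extended
        functional annihilate \<open>v1\<close>, hence all of \<open>V\<close>, which is spanned by
        \<open>v1\<close> and its members vanishing at \<open>e\<close>.\<close>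
      define c where "c = (\<Sum>e'\<in>E. b e' * v1 e')"
      have upd: "(\<Sum>e'\<in>insert e E. (b(e := - c)) e' * f e') = (\<Sum>e'\<in>E. b e' * f e') - c * f e" for f
      proof -
        have "(\<Sum>e'\<in>E. (b(e := - c)) e' * f e') = (\<Sum>e'\<in>E. b e' * f e')"
          using insert.hyps by (intro sum.cong) auto
        then show ?thesis using insert.hyps by simp
      qed
      have "(\<Sum>e'\<in>insert e E. (b(e := - c)) e' * s e') = 0"
      proof (rule insert.prems(2), rule ballI)
        fix v assume v: "v \<in> V"
        have "(\<lambda>e'. v e' + (- v e) * v1 e') \<in> V"
          using pointwise_subspace_add_scaled[OF insert.prems(1)] v v1 by blast
        then have "(\<Sum>e'\<in>E. b e' * (v e' + (- v e) * v1 e')) = 0" using b v1 by simp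
        then have "(\<Sum>e'\<in>E. b e' * v e') = c * v e"
          by (simp add: c_def algebra_simps sum_subtractf sum_distrib_left)
        then show "(\<Sum>e'\<in>insert e E. (b(e := - c)) e' * v e') = 0" by (simp only: upd)
      qed
      then have "(\<Sum>e'\<in>E. b e' * s e') = c * s e" by (simp only: upd)
      then show "(\<Sum>e'\<in>E. b e' * (s e' - s e * v1 e')) = 0"
        by (simp add: c_def algebra_simps sum_subtractf sum_distrib_left)
    qed
    then obtain v where v: "v \<in> V" "v e = 0" "\<And>e'. e' \<in> E \<Longrightarrow> v e' = s e' - s e * v1 e'" by blast
    then have "(\<lambda>e'. v e' + s e * v1 e') \<in> V"
      using pointwise_subspace_add_scaled[OF insert.prems(1)] v1 by blast
    then show ?thesis
      by (rule bexI[rotated]) (use v v1 in auto)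
  qed
qed

text \<open>A functional annihilating \<open>V\<close> annihilates every \<open>X N\<close> and,
  being a finite sum, also the limit; the double annihilator then gives a member of
  \<open>V\<close>.\<close>

lemma pointwise_subspace_seq_closed:
  assumes "finite E" and "pointwise_subspace V" and X: "\<And>N. X N \<in> V"
    and lim: "\<And>e. e \<in> E \<Longrightarrow> (\<lambda>N. X N e) \<longlonglongrightarrow> l e"
  shows "\<exists>v\<in>V. \<forall>e\<in>E. v e = l e"
proof (rule mem_biannihilator[OF assms(1,2)])
  fix b assume b: "\<forall>v\<in>V. (\<Sum>e\<in>E. b e * v e) = 0"
  have "(\<lambda>N. \<Sum>e\<in>E. b e * X N e) \<longlonglongrightarrow> (\<Sum>e\<in>E. b e * l e)"
    by (intro tendsto_intros lim)
  then show "(\<Sum>e\<in>E. b e * l e) = 0" using b X by (simp add: LIMSEQ_const_iff)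
qed

subsection \<open>Maximizing a linear form under exponential constraints\<close>

text \<open>In the application \<open>E\<close> is the joint support of the kernels and
  \<open>cls\<close> sends an entry to its time and row, so that this is a row sum.\<close>

definition fibre_sum :: "'e set \<Rightarrow> ('e \<Rightarrow> 'r) \<Rightarrow> ('e \<Rightarrow> real) \<Rightarrow> 'r \<Rightarrow> real" where
  "fibre_sum E cls f r = (\<Sum>e | e \<in> E \<and> cls e = r. f e)"

lemma sum_fibre_sum:
  assumes "finite E"
  shows "(\<Sum>r\<in>cls ` E. g r * fibre_sum E cls f r) = (\<Sum>e\<in>E. g (cls e) * f e)"
proof -
  have "(\<Sum>r\<in>cls ` E. g r * fibre_sum E cls f r)
      = (\<Sum>r\<in>cls ` E. \<Sum>e | e \<in> E \<and> cls e = r. g (cls e) * f e)"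
    unfolding fibre_sum_def sum_distrib_left by (intro sum.cong) auto
  also have "\<dots> = (\<Sum>e\<in>E. g (cls e) * f e)"
    using assms by (intro sum.group) auto
  finally show ?thesis .
qed

lemma fibre_sum_nonneg: "(\<And>e. e \<in> E \<Longrightarrow> f e \<ge> 0) \<Longrightarrow> fibre_sum E cls f r \<ge> 0"
  unfolding fibre_sum_def by (intro sum_nonneg) auto

lemma le_fibre_sum:
  assumes "finite E" and "e \<in> E" and "\<And>e. e \<in> E \<Longrightarrow> f e \<ge> 0"
  shows "f e \<le> fibre_sum E cls f (cls e)"
  unfolding fibre_sum_def
  by (rule member_le_sum) (use assms in auto)

lemma tendsto_fibre_sum_exp:
  assumes "\<And>e. e \<in> E \<Longrightarrow> ((\<lambda>x. s x e) \<longlongrightarrow> l e) F"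
  shows "((\<lambda>x. fibre_sum E cls (\<lambda>e. a e * exp (s x e)) r)
    \<longlongrightarrow> fibre_sum E cls (\<lambda>e. a e * exp (l e)) r) F"
  unfolding fibre_sum_def by (intro tendsto_intros) (use assms in auto)

text \<open>This is \<open>ln y \<le> y - 1\<close> at \<open>y = 1 / x\<close>, multiplied by
  \<open>x\<close>.\<close>

lemma entropy_lower_bound: "x - 1 \<le> x * ln x" if "x > 0" for x :: real
proof -
  have "- ln x \<le> 1 / x - 1" using that ln_le_minus_one[of "1/x"] by (simp add: ln_div)
  then have "x * (- ln x) \<le> x * (1 / x - 1)" using that by (intro mult_left_mono) auto
  then show ?thesis using that by (simp add: algebra_simps)
qed

text \<open>The dual problem in the variable \<open>s\<close>, the logarithmic tilt:
  \<open>a\<close> stands for the kernels, \<open>m\<close> for the positive feasible point,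
  \<open>V\<close> for the tilts coming from multipliers. By \<open>a_sum\<close>,
  \<open>s = 0\<close> satisfies every constraint with equality.\<close>

locale exponential_program =
  fixes E :: "'e set" and cls :: "'e \<Rightarrow> 'r" and a m :: "'e \<Rightarrow> real" and V :: "('e \<Rightarrow> real) set"
  assumes finE: "finite E"
    and a_pos: "\<And>e. e \<in> E \<Longrightarrow> a e > 0"
    and m_pos: "\<And>e. e \<in> E \<Longrightarrow> m e > 0"
    and a_sum: "\<And>r. r \<in> cls ` E \<Longrightarrow> fibre_sum E cls a r = 1"
    and V: "pointwise_subspace V"
begin

abbreviation "lin s \<equiv> \<Sum>e\<in>E. m e * s e"
abbreviation "Z s r \<equiv> fibre_sum E cls (\<lambda>e. a e * exp (s e)) r"

text \<open>The weight \<open>\<delta>\<close> also relaxes the constraint to \<open>Z s r < 1 + \<delta>\<close>: the original constraints may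
  have no strictly feasible point in \<open>V\<close>, whereas \<open>s = 0\<close> is always strictly feasible here.\<close>
definition barrier :: "real \<Rightarrow> ('e \<Rightarrow> real) \<Rightarrow> real" where
  "barrier \<delta> s = lin s + \<delta> * (\<Sum>r\<in>cls ` E. ln (1 + \<delta> - Z s r))"

definition superlevel :: "real \<Rightarrow> ('e \<Rightarrow> real) set" where
  "superlevel \<delta> = {s \<in> V. (\<forall>r\<in>cls ` E. Z s r < 1 + \<delta>) \<and> barrier \<delta> (\<lambda>_. 0) \<le> barrier \<delta> s}"

text \<open>The 2 bounds \<open>1 + \<delta>\<close> for \<open>\<delta> \<le> 1\<close>. The
  absolute value makes the bound nonnegative, so that sums of it may be enlarged to all of
  \<open>E\<close>.\<close>

definition upper :: "'e \<Rightarrow> real" where "upper e = \<bar>ln (2 / a e)\<bar>"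

text \<open>One \<open>card\<close> bounds the barrier at 0 from below, the other bounds the
  logarithmic terms from above; the last sum bounds \<open>lin\<close>. Nothing here depends on
  \<open>\<delta>\<close>.\<close>

definition loss :: real where "loss = 2 * card (cls ` E) + (\<Sum>e\<in>E. m e * upper e)"

lemma Z_nonneg: "Z s r \<ge> 0"
  by (intro fibre_sum_nonneg) (use a_pos in \<open>auto intro: less_imp_le\<close>)

lemma Z_ge: "e \<in> E \<Longrightarrow> a e * exp (s e) \<le> Z s (cls e)"
  by (rule le_fibre_sum) (use finE a_pos in \<open>auto intro: less_imp_le\<close>)

lemma Z_pos: "r \<in> cls ` E \<Longrightarrow> Z s r > 0"
proof -
  assume "r \<in> cls ` E"
  then obtain e where e: "e \<in> E" "r = cls e" by blast
  have "0 < a e * exp (s e)" using a_pos[OF e(1)] by simp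
  then show ?thesis using Z_ge[OF e(1), of s] unfolding e(2) by linarith
qed

lemma le_upper: "s e \<le> upper e" if "e \<in> E" "Z s (cls e) \<le> 2"
proof -
  have "a e * exp (s e) \<le> 2" using Z_ge[OF that(1), of s] that by linarith
  then have "exp (s e) \<le> 2 / a e" using a_pos[OF that(1)] by (simp add: field_simps)
  then have "s e \<le> ln (2 / a e)" by (metis exp_gt_zero less_le_trans ln_exp ln_le_cancel_iff)
  then show ?thesis unfolding upper_def by linarith
qed

lemma barrier_zero: "barrier \<delta> (\<lambda>_. 0) = card (cls ` E) * (\<delta> * ln \<delta>)"
  unfolding barrier_def using a_sum by simp

text \<open>Since \<open>\<delta> * ln \<delta> \<ge> \<delta> - 1 \<ge> -1\<close>, the reference
  value stays bounded as \<open>\<delta>\<close> tends to 0, which keeps the bounds on the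
  maximizers uniform.\<close>

lemma barrier_zero_ge: "barrier \<delta> (\<lambda>_. 0) \<ge> - real (card (cls ` E))" if "\<delta> > 0"
proof -
  have "real (card (cls ` E)) * (-1) \<le> card (cls ` E) * (\<delta> * ln \<delta>)"
    using entropy_lower_bound[OF that] that by (intro mult_left_mono) auto
  then show ?thesis by (simp add: barrier_zero)
qed

section \<open>Compactness of the superlevel set and the barrier maximizer\<close>

context
  fixes \<delta> :: real
  assumes \<delta>: "0 < \<delta>" "\<delta> \<le> 1"
begin

lemma zero_mem_superlevel: "(\<lambda>_. 0) \<in> superlevel \<delta>"
  using V a_sum \<delta> unfolding superlevel_def pointwise_subspace_def by simp

lemma ln_slack_le: "ln (1 + \<delta> - Z s r) \<le> 1" if "Z s r < 1 + \<delta>"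
  using ln_le_minus_one[of "1 + \<delta> - Z s r"] that Z_nonneg[of s r] \<delta> by linarith

lemma superlevel_lin_le: "lin s \<le> (\<Sum>e\<in>E. m e * upper e)" if "s \<in> superlevel \<delta>"
  by (intro sum_mono mult_left_mono le_upper)
    (use that m_pos \<delta> in \<open>auto simp: superlevel_def intro: less_imp_le dest!: bspec\<close>)

text \<open>The barrier value is at least \<open>- card\<close>, and its logarithmic part
  contributes at most \<open>\<delta> * card \<le> card\<close>, each logarithm being at most
  1.\<close>

lemma superlevel_lin_ge: "lin s \<ge> - 2 * real (card (cls ` E))" if "s \<in> superlevel \<delta>"
proof -
  have "(\<Sum>r\<in>cls ` E. ln (1 + \<delta> - Z s r)) \<le> (\<Sum>r\<in>cls ` E. 1)"
    by (intro sum_mono ln_slack_le) (use that in \<open>auto simp: superlevel_def\<close>)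
  then have "\<delta> * (\<Sum>r\<in>cls ` E. ln (1 + \<delta> - Z s r)) \<le> \<delta> * card (cls ` E)"
    using \<delta> by (intro mult_left_mono) auto
  also have "\<dots> \<le> card (cls ` E)" using \<delta> by (simp add: mult_left_le_one_le)
  finally show ?thesis
    using that barrier_zero_ge[of \<delta>] \<delta> unfolding superlevel_def barrier_def by auto
qed

text \<open>The weighted sum is bounded below and every other term above, so \<open>m e > 0\<close>
  bounds \<open>s e\<close> below. The bound is free of \<open>\<delta>\<close>, so maximizers for
  different \<open>\<delta>\<close> share a convergent subsequence.\<close>

lemma superlevel_bounded: "\<bar>s e\<bar> \<le> upper e + loss / m e" if "s \<in> superlevel \<delta>" "e \<in> E"
proof -
  have up: "s e' \<le> upper e'" if "e' \<in> E" for e'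
    by (rule le_upper) (use that \<open>s \<in> superlevel \<delta>\<close> \<delta> in \<open>auto simp: superlevel_def dest!: bspec[where x="cls e'"]\<close>)
  have up0: "0 \<le> upper e'" for e' unfolding upper_def by simp
  have "(\<Sum>e'\<in>E - {e}. m e' * s e') \<le> (\<Sum>e'\<in>E - {e}. m e' * upper e')"
    by (intro sum_mono mult_left_mono) (use up m_pos in \<open>auto intro: less_imp_le\<close>)
  also have "\<dots> \<le> (\<Sum>e'\<in>E. m e' * upper e')"
    by (intro sum_mono2) (use finE m_pos up0 in \<open>auto intro: less_imp_le mult_nonneg_nonneg\<close>)
  finally have "m e * s e \<ge> - loss"
    using superlevel_lin_ge[OF that(1)] sum.remove[OF finE that(2), of "\<lambda>e. m e * s e"]
    unfolding loss_def by simp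
  then have "s e \<ge> - loss / m e" using m_pos[OF that(2)] by (simp add: field_simps)
  moreover have "loss / m e \<ge> 0"
  proof -
    have "loss \<ge> 0"
      unfolding loss_def using m_pos up0
      by (intro add_nonneg_nonneg sum_nonneg mult_nonneg_nonneg) (auto intro: less_imp_le)
    then show ?thesis using m_pos[OF that(2)] by simp
  qed
  ultimately show ?thesis using up[OF that(2)] up0[of e] by (simp add: abs_le_iff)
qed

text \<open>With \<open>lin\<close> and all other logarithms bounded above, a bounded barrier value
  keeps each single logarithm away from minus infinity. For fixed \<open>\<delta>\<close>, limits
  therefore stay strictly inside the domain of the barrier.\<close>

lemma superlevel_slack: "1 + \<delta> - Z s r \<ge> exp (- loss / \<delta>)" if "s \<in> superlevel \<delta>" "r \<in> cls ` E"
proof -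
  let ?l = "\<lambda>r. ln (1 + \<delta> - Z s r)"
  have fin: "finite (cls ` E)" using finE by simp
  have "(\<Sum>r\<in>cls ` E - {r}. ?l r) \<le> (\<Sum>r\<in>cls ` E - {r}. 1)"
    by (intro sum_mono ln_slack_le) (use that in \<open>auto simp: superlevel_def\<close>)
  also have "\<dots> \<le> (\<Sum>r\<in>cls ` E. 1)" by (rule sum_mono2) (use fin in auto)
  finally have "\<delta> * (\<Sum>r\<in>cls ` E - {r}. ?l r) \<le> \<delta> * card (cls ` E)"
    using \<delta> by (intro mult_left_mono) auto
  also have "\<dots> \<le> card (cls ` E)" using \<delta> by (simp add: mult_left_le_one_le)
  finally have *: "\<delta> * (\<Sum>r\<in>cls ` E - {r}. ?l r) \<le> card (cls ` E)" .
  have "(\<Sum>r\<in>cls ` E. ?l r) = ?l r + (\<Sum>r\<in>cls ` E - {r}. ?l r)"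
    using fin that by (rule_tac sum.remove)
  moreover have "barrier \<delta> s \<ge> - real (card (cls ` E))"
    using that barrier_zero_ge[of \<delta>] \<delta> unfolding superlevel_def by auto
  ultimately have "\<delta> * ?l r \<ge> - loss"
    using * superlevel_lin_le[OF that(1)] unfolding barrier_def loss_def
    by (simp add: distrib_left)
  then have "?l r \<ge> - loss / \<delta>" using \<delta> by (simp add: field_simps)
  moreover have "1 + \<delta> - Z s r > 0" using that unfolding superlevel_def by auto
  ultimately show ?thesis by (metis exp_le_cancel_iff exp_ln)
qed

text \<open>The pointwise limit on \<open>E\<close> is realized by a member of \<open>V\<close>; the
  uniform slack keeps its constraints strict, so the barrier is continuous there.\<close>

lemma superlevel_seq_compact:
  assumes "\<And>N. X N \<in> superlevel \<delta>"
  shows "\<exists>r l. strict_mono (r :: nat \<Rightarrow> nat) \<and> l \<in> superlevel \<delta> \<and>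
    (\<lambda>N. barrier \<delta> (X (r N))) \<longlonglongrightarrow> barrier \<delta> l"
proof -
  have bound: "\<bar>X N e\<bar> \<le> upper e + loss / m e" if "e \<in> E" for N e
    by (rule superlevel_bounded[OF assms that])
  have XV: "X N \<in> V" for N using assms[of N] unfolding superlevel_def by blast
  obtain r l where r: "strict_mono (r :: nat \<Rightarrow> nat)"
    and l: "\<And>e. e \<in> E \<Longrightarrow> (\<lambda>N. X (r N) e) \<longlonglongrightarrow> l e"
    using finite_convergent_subsequence[of E X, OF finE bound] by blast
  obtain v where v: "v \<in> V" "\<And>e. e \<in> E \<Longrightarrow> v e = l e"
    using pointwise_subspace_seq_closed[OF finE V, of "\<lambda>N. X (r N)" l] XV l by blast
  have lv: "(\<lambda>N. X (r N) e) \<longlonglongrightarrow> v e" if "e \<in> E" for e using l v that by simp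
  have Z: "(\<lambda>N. Z (X (r N)) q) \<longlonglongrightarrow> Z v q" for q by (rule tendsto_fibre_sum_exp[OF lv])
  have slack: "1 + \<delta> - Z v q \<ge> exp (- loss / \<delta>)" if "q \<in> cls ` E" for q
    by (rule LIMSEQ_le_const[OF tendsto_diff[OF tendsto_const Z]])
      (use superlevel_slack[OF assms that] in auto)
  have pos: "Z v q < 1 + \<delta>" if "q \<in> cls ` E" for q
    using slack[OF that] exp_gt_zero[of "- loss / \<delta>"] by linarith
  have lim: "(\<lambda>N. barrier \<delta> (X (r N))) \<longlonglongrightarrow> barrier \<delta> v"
    unfolding barrier_def by (intro tendsto_intros lv Z) (use pos in fastforce)+
  have "barrier \<delta> (\<lambda>_. 0) \<le> barrier \<delta> v"
    by (rule LIMSEQ_le_const[OF lim]) (use assms in \<open>auto simp: superlevel_def\<close>)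
  then show ?thesis using r v pos lim unfolding superlevel_def by blast
qed

text \<open>The first-order condition says that the weights \<open>\<delta> a exp s / (1 + \<delta> - Z)\<close> pair with \<open>V\<close>
  exactly as \<open>m\<close> does, i.e. that they form a feasible point of the primal problem.\<close>
lemma barrier_stationary:
  "\<exists>s\<in>superlevel \<delta>. \<forall>v\<in>V. (\<Sum>e\<in>E. \<delta> * (a e * exp (s e)) / (1 + \<delta> - Z s (cls e)) * v e) = lin v"
proof -
  obtain s where s: "s \<in> superlevel \<delta>" and max: "\<And>x. x \<in> superlevel \<delta> \<Longrightarrow> barrier \<delta> x \<le> barrier \<delta> s"
    using seq_compact_attains_max[OF zero_mem_superlevel superlevel_seq_compact] by blast
  have "(\<Sum>e\<in>E. \<delta> * (a e * exp (s e)) / (1 + \<delta> - Z s (cls e)) * v e) = lin v" if v: "v \<in> V" for v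
  proof -
    let ?p = "\<lambda>t e. s e + t * v e"
    have p0: "?p 0 = s" by simp
    have pV: "?p t \<in> V" for t
      using pointwise_subspace_add_scaled[OF V] s v unfolding superlevel_def by blast
    have Zs: "Z s r < 1 + \<delta>" if "r \<in> cls ` E" for r using s that unfolding superlevel_def by blast
    have "\<forall>\<^sub>F t in at 0. Z (?p t) r < 1 + \<delta>" if "r \<in> cls ` E" for r
    proof (rule order_tendstoD(2)[OF _ Zs[OF that]])
      have "((\<lambda>t. ?p t e) \<longlongrightarrow> s e + 0 * v e) (at 0)" for e by (intro tendsto_intros)
      then show "((\<lambda>t. Z (?p t) r) \<longlongrightarrow> Z s r) (at 0)"
        by (intro tendsto_fibre_sum_exp) simp
    qed
    then have "\<forall>\<^sub>F t in at 0. \<forall>r\<in>cls ` E. Z (?p t) r < 1 + \<delta>"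
      using finE by (simp add: eventually_ball_finite)
    then obtain d where d: "d > 0"
      and near: "\<And>t. t \<noteq> 0 \<Longrightarrow> dist t 0 < d \<Longrightarrow> \<forall>r\<in>cls ` E. Z (?p t) r < 1 + \<delta>"
      unfolding eventually_at by auto
    \<comment> \<open>Near 0 the perturbed point is strictly feasible but may leave the superlevel
      set. Then its barrier value lies below the value at the zero function, hence below the
      maximum.\<close>
    have locmax: "barrier \<delta> (?p t) \<le> barrier \<delta> (?p 0)" if "\<bar>0 - t\<bar> < d" for t
    proof (cases "t = 0 \<or> barrier \<delta> (?p t) < barrier \<delta> (\<lambda>_. 0)")
      case True
      then show ?thesis using max[OF zero_mem_superlevel] p0 by force
    next
      case False
      then have "?p t \<in> superlevel \<delta>" using near[of t] that pV unfolding superlevel_def by auto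
      then show ?thesis using max p0 by simp
    qed
    have dZ: "((\<lambda>t. Z (?p t) r) has_real_derivative
        fibre_sum E cls (\<lambda>e. a e * exp (s e) * v e) r) (at 0)" for r
      unfolding fibre_sum_def by (auto intro!: derivative_eq_intros sum.cong)
    have "((\<lambda>t. barrier \<delta> (?p t)) has_real_derivative
        (lin v + \<delta> * (\<Sum>r\<in>cls ` E. (- fibre_sum E cls (\<lambda>e. a e * exp (s e) * v e) r) / (1 + \<delta> - Z s r)))) (at 0)"
      unfolding barrier_def
      by ((rule derivative_eq_intros dZ refl | use Zs in force)+) (simp add: mult.commute sum_negf)
    then have "lin v + \<delta> * (\<Sum>r\<in>cls ` E. (- fibre_sum E cls (\<lambda>e. a e * exp (s e) * v e) r) / (1 + \<delta> - Z s r)) = 0"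
      using locmax d by (intro DERIV_local_max) auto
    moreover have "\<delta> * (\<Sum>r\<in>cls ` E. (- fibre_sum E cls (\<lambda>e. a e * exp (s e) * v e) r) / (1 + \<delta> - Z s r))
       = (\<Sum>r\<in>cls ` E. - \<delta> / (1 + \<delta> - Z s r) * fibre_sum E cls (\<lambda>e. a e * exp (s e) * v e) r)"
      by (simp add: sum_distrib_left sum_negf)
    moreover have "\<dots> = (\<Sum>e\<in>E. - \<delta> / (1 + \<delta> - Z s (cls e)) * (a e * exp (s e) * v e))"
      by (rule sum_fibre_sum[OF finE])
    ultimately show ?thesis by (simp add: sum_negf mult.assoc)
  qed
  then show ?thesis using s by blast
qed

text \<open>For the weights \<open>M\<close> of the stationarity condition, \<open>M e\<close> over
  its row sum times \<open>a e\<close> is \<open>exp (s e) / Z\<close>. The objective thus splits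
  into the pairing of \<open>M\<close> with \<open>s\<close>, equal to \<open>lin s\<close>, and one
  term \<open>\<delta> * (- Z ln Z) / (1 + \<delta> - Z)\<close> per row, at most
  \<open>\<delta>\<close> because \<open>- Z ln Z \<le> 1 - Z\<close>.\<close>

lemma approximate_primal:
  "\<exists>s\<in>superlevel \<delta>. \<exists>M. (\<forall>e\<in>E. M e \<ge> 0) \<and> (\<forall>v\<in>V. (\<Sum>e\<in>E. M e * v e) = lin v) \<and>
    (\<Sum>e\<in>E. M e * ln (M e / (fibre_sum E cls M (cls e) * a e))) \<le> lin s + \<delta> * card (cls ` E)"
proof -
  obtain s where s: "s \<in> superlevel \<delta>"
    and stat: "\<And>v. v \<in> V \<Longrightarrow> (\<Sum>e\<in>E. \<delta> * (a e * exp (s e)) / (1 + \<delta> - Z s (cls e)) * v e) = lin v"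
    using barrier_stationary by blast
  define M where "M e = \<delta> * (a e * exp (s e)) / (1 + \<delta> - Z s (cls e))" for e
  have slack: "1 + \<delta> - Z s r > 0" if "r \<in> cls ` E" for r using s that unfolding superlevel_def by auto
  have M_pos: "M e > 0" if "e \<in> E" for e
    unfolding M_def using that slack a_pos \<delta> by (intro divide_pos_pos mult_pos_pos) auto
  have M_fibre: "fibre_sum E cls M r = \<delta> * Z s r / (1 + \<delta> - Z s r)" for r
    unfolding fibre_sum_def M_def sum_distrib_left sum_divide_distrib by (intro sum.cong) auto
  have eq: "M e * ln (M e / (fibre_sum E cls M (cls e) * a e))
     = M e * s e + (- ln (Z s (cls e))) * M e" if e: "e \<in> E" for e
  proof -
    have "M e / (fibre_sum E cls M (cls e) * a e) = exp (s e) / Z s (cls e)"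
      unfolding M_fibre M_def using \<delta> slack[of "cls e"] a_pos[OF e] Z_pos[of "cls e" s] e
      by (simp add: divide_simps)
    then show ?thesis using Z_pos[of "cls e" s] e by (simp add: ln_div algebra_simps)
  qed
  have "(\<Sum>e\<in>E. M e * ln (M e / (fibre_sum E cls M (cls e) * a e)))
      = (\<Sum>e\<in>E. M e * s e) + (\<Sum>e\<in>E. (- ln (Z s (cls e))) * M e)"
    unfolding sum.distrib[symmetric] by (intro sum.cong eq refl)
  also have "(\<Sum>e\<in>E. M e * s e) = lin s"
    using stat s unfolding superlevel_def M_def by simp
  also have "(\<Sum>e\<in>E. (- ln (Z s (cls e))) * M e)
      = (\<Sum>r\<in>cls ` E. (- ln (Z s r)) * fibre_sum E cls M r)"
    by (rule sum_fibre_sum[OF finE, symmetric])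
  also have "\<dots> \<le> (\<Sum>r\<in>cls ` E. \<delta>)"
  proof (rule sum_mono)
    fix r assume r: "r \<in> cls ` E"
    let ?z = "Z s r"
    have z: "?z > 0" using Z_pos r by blast
    have "?z * (- ln ?z) \<le> 1 - ?z" using entropy_lower_bound[OF z] by simp
    also have "\<dots> \<le> 1 + \<delta> - ?z" using \<delta> by simp
    finally have "\<delta> * (?z * (- ln ?z)) \<le> \<delta> * (1 + \<delta> - ?z)"
      using \<delta> by (intro mult_left_mono) auto
    then show "(- ln ?z) * fibre_sum E cls M r \<le> \<delta>"
      unfolding M_fibre using slack[OF r] by (simp add: field_simps)
  qed
  finally have "(\<Sum>e\<in>E. M e * ln (M e / (fibre_sum E cls M (cls e) * a e)))
      \<le> lin s + \<delta> * card (cls ` E)"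
    by (simp add: mult.commute)
  moreover have "(\<Sum>e\<in>E. M e * v e) = lin v" if "v \<in> V" for v
    using stat[OF that] unfolding M_def .
  ultimately show ?thesis using s M_pos less_imp_le by blast
qed

end

text \<open>Along \<open>\<delta> = 1 / (N + 1)\<close> the uniformly bounded maximizers converge on
  \<open>E\<close> after thinning; the relaxed constraints become \<open>Z \<le> 1\<close> and the
  gap \<open>\<delta> * card\<close> vanishes. Primal points are asked for only within each
  \<open>\<epsilon>\<close>, so only the maximizers have to converge.\<close>

lemma strong_duality:
  "\<exists>s\<in>V. (\<forall>r\<in>cls ` E. Z s r \<le> 1) \<and>
    (\<forall>\<epsilon>>0. \<exists>M. (\<forall>e\<in>E. M e \<ge> 0) \<and> (\<forall>v\<in>V. (\<Sum>e\<in>E. M e * v e) = lin v) \<and>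
      (\<Sum>e\<in>E. M e * ln (M e / (fibre_sum E cls M (cls e) * a e))) \<le> lin s + \<epsilon>)"
proof -
  define \<delta> where "\<delta> N = 1 / real (Suc N)" for N
  have \<delta>: "0 < \<delta> N" "\<delta> N \<le> 1" for N unfolding \<delta>_def by auto
  have \<delta>0: "\<delta> \<longlonglongrightarrow> 0" unfolding \<delta>_def by (rule LIMSEQ_Suc[OF lim_1_over_n])
  define P where "P N s M \<longleftrightarrow> s \<in> superlevel (\<delta> N) \<and> (\<forall>e\<in>E. M e \<ge> 0) \<and>
     (\<forall>v\<in>V. (\<Sum>e\<in>E. M e * v e) = lin v) \<and>
     (\<Sum>e\<in>E. M e * ln (M e / (fibre_sum E cls M (cls e) * a e))) \<le> lin s + \<delta> N * card (cls ` E)"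
    for N s M
  have "\<forall>N. \<exists>s M. P N s M"
    using approximate_primal[OF \<delta>] unfolding P_def by blast
  from choice[OF this] obtain X where "\<forall>N. \<exists>M. P N (X N) M" by blast
  from choice[OF this] obtain M where P: "\<And>N. P N (X N) (M N)" by blast
  have X: "X N \<in> superlevel (\<delta> N)" for N using P[of N] unfolding P_def by blast
  have M: "(\<forall>e\<in>E. M N e \<ge> 0) \<and> (\<forall>v\<in>V. (\<Sum>e\<in>E. M N e * v e) = lin v)" for N
    using P[of N] unfolding P_def by blast
  have val: "(\<Sum>e\<in>E. M N e * ln (M N e / (fibre_sum E cls (M N) (cls e) * a e)))
       \<le> lin (X N) + \<delta> N * card (cls ` E)" for N
    using P[of N] unfolding P_def by blast
  have bound: "\<bar>X N e\<bar> \<le> upper e + loss / m e" if "e \<in> E" for N e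
    by (rule superlevel_bounded[OF \<delta>(1) \<delta>(2) X that])
  have XV: "X N \<in> V" for N using X[of N] unfolding superlevel_def by blast
  obtain r l where r: "strict_mono (r :: nat \<Rightarrow> nat)"
    and l: "\<And>e. e \<in> E \<Longrightarrow> (\<lambda>N. X (r N) e) \<longlonglongrightarrow> l e"
    using finite_convergent_subsequence[of E X, OF finE bound] by blast
  obtain v where v: "v \<in> V" "\<And>e. e \<in> E \<Longrightarrow> v e = l e"
    using pointwise_subspace_seq_closed[OF finE V, of "\<lambda>N. X (r N)" l] XV l by blast
  have lv: "(\<lambda>N. X (r N) e) \<longlonglongrightarrow> v e" if "e \<in> E" for e using l v that by simp
  have \<delta>r: "(\<lambda>N. \<delta> (r N)) \<longlonglongrightarrow> 0" using LIMSEQ_subseq_LIMSEQ[OF \<delta>0 r] by (simp add: o_def)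
  have "Z v q \<le> 1" if "q \<in> cls ` E" for q
  proof -
    have "(\<lambda>N. 1 + \<delta> (r N)) \<longlonglongrightarrow> 1 + 0" by (intro tendsto_intros \<delta>r)
    then have "(\<lambda>N. 1 + \<delta> (r N)) \<longlonglongrightarrow> 1" by simp
    moreover have "Z (X (r N)) q \<le> 1 + \<delta> (r N)" for N
      using X[of "r N"] that unfolding superlevel_def by (auto intro: less_imp_le)
    ultimately show ?thesis
      by (intro LIMSEQ_le[OF tendsto_fibre_sum_exp[OF lv]]) auto
  qed
  moreover have "\<exists>M. (\<forall>e\<in>E. M e \<ge> 0) \<and> (\<forall>v\<in>V. (\<Sum>e\<in>E. M e * v e) = lin v) \<and>
      (\<Sum>e\<in>E. M e * ln (M e / (fibre_sum E cls M (cls e) * a e))) \<le> lin v + \<epsilon>" if "\<epsilon> > 0" for \<epsilon>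
  proof -
    have "(\<lambda>N. lin (X (r N)) + \<delta> (r N) * card (cls ` E)) \<longlonglongrightarrow> lin v + 0 * real (card (cls ` E))"
      by (intro tendsto_intros lv \<delta>r)
    then have "\<forall>\<^sub>F N in sequentially. lin (X (r N)) + \<delta> (r N) * card (cls ` E) < lin v + \<epsilon>"
      by (rule order_tendstoD) (use that in simp)
    then obtain N where "lin (X (r N)) + \<delta> (r N) * card (cls ` E) < lin v + \<epsilon>"
      using eventually_happens'[OF sequentially_bot] by blast
    then have "(\<Sum>e\<in>E. M (r N) e * ln (M (r N) e / (fibre_sum E cls (M (r N)) (cls e) * a e)))
        \<le> lin v + \<epsilon>"
      using val[of "r N"] by linarith
    then show ?thesis using M[of "r N"] by (intro exI[of _ "M (r N)"]) simp
  qed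
  ultimately show ?thesis using v(1) by blast
qed

end

subsection \<open>The Lagrangian and the dual function\<close>

lemma mult_ones_index:
  assumes "M \<in> carrier_mat n n" and "i < n"
  shows "(M *\<^sub>v ones_vec n) $ i = (\<Sum>j<n. M $$ (i, j))"
  using assms by (simp add: ones_vec_def scalar_prod_def atLeast0LessThan)

lemma transpose_mult_ones_index:
  assumes "M \<in> carrier_mat n n" and "j < n"
  shows "(M\<^sup>T *\<^sub>v ones_vec n) $ j = (\<Sum>i<n. M $$ (i, j))"
  using assms by (simp add: ones_vec_def scalar_prod_def atLeast0LessThan)

lemma ones_vec_carrier [simp]: "ones_vec n \<in> carrier_vec n"
  by (simp add: ones_vec_def)

lemma mult_diag_left_index:
  assumes "P \<in> carrier_mat n n" and "v \<in> carrier_vec n" and "i < n" and "j < n"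
  shows "(diag v * P) $$ (i, j) = v $ i * P $$ (i, j)"
  using assms mat_diag_mult_left[OF assms(1), of "\<lambda>i. v $ i"] by (simp add: diag_def)

lemma mult_diag_right_index:
  assumes "P \<in> carrier_mat n n" and "v \<in> carrier_vec n" and "i < n" and "j < n"
  shows "(P * diag v) $$ (i, j) = P $$ (i, j) * v $ j"
  using assms mat_diag_mult_right[OF assms(1), of "\<lambda>i. v $ i"] by (simp add: diag_def)

lemma diag_carrier [simp]: "v \<in> carrier_vec n \<Longrightarrow> diag v \<in> carrier_mat n n"
  by (auto simp: diag_def)

lemma mult_diag_vec_index:
  assumes "v \<in> carrier_vec n" and "x \<in> carrier_vec n" and "i < n"
  shows "(diag v *\<^sub>v x) $ i = v $ i * x $ i"
proof -
  have "(diag v *\<^sub>v x) $ i = (\<Sum>j<n. (if i = j then v $ j else 0) * x $ j)"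
    using assms by (simp add: diag_def mat_diag_def scalar_prod_def atLeast0LessThan)
  also have "\<dots> = (\<Sum>j<n. if j = i then v $ j * x $ j else 0)"
    by (intro sum.cong) auto
  finally show ?thesis using assms(3) by simp
qed

lemma row_stochasticD:
  assumes "row_stochastic n P"
  shows "P \<in> carrier_mat n n" and "i < n \<Longrightarrow> j < n \<Longrightarrow> P $$ (i, j) \<ge> 0"
    and "i < n \<Longrightarrow> (\<Sum>j<n. P $$ (i, j)) = 1"
proof -
  show P: "P \<in> carrier_mat n n" using assms unfolding row_stochastic_def by blast
  show "P $$ (i, j) \<ge> 0" if "i < n" "j < n"
    using assms that P unfolding row_stochastic_def less_eq_mat_def by auto
  show "(\<Sum>j<n. P $$ (i, j)) = 1" if "i < n"
    using assms mult_ones_index[OF P that] that unfolding row_stochastic_def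
    by (simp add: ones_vec_def)
qed

lemma primal_domainD:
  assumes "M \<in> primal_domain n T A" and "t < T"
  shows "M t \<in> carrier_mat n n" and "i < n \<Longrightarrow> j < n \<Longrightarrow> M t $$ (i, j) \<ge> 0"
    and "i < n \<Longrightarrow> j < n \<Longrightarrow> A t $$ (i, j) = 0 \<Longrightarrow> M t $$ (i, j) = 0"
proof -
  show M: "M t \<in> carrier_mat n n" using assms unfolding primal_domain_def by blast
  show "M t $$ (i, j) \<ge> 0" if "i < n" "j < n"
  proof -
    have "0\<^sub>m n n \<le> M t" using assms unfolding primal_domain_def by blast
    then show ?thesis using that M unfolding less_eq_mat_def by simp
  qed
  show "M t $$ (i, j) = 0" if "i < n" "j < n" "A t $$ (i, j) = 0"
  proof (rule ccontr)
    assume "M t $$ (i, j) \<noteq> 0"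
    then have "(i, j) \<in> supp_mat (M t)" using M that unfolding supp_mat_def by simp
    then have "(i, j) \<in> supp_mat (A t)" using assms unfolding primal_domain_def by blast
    then show False using that unfolding supp_mat_def by simp
  qed
qed

lemma primal_domainI:
  assumes "\<And>t. t < T \<Longrightarrow> M t \<in> carrier_mat n n" and "\<And>t. t < T \<Longrightarrow> A t \<in> carrier_mat n n"
    and "\<And>t i j. t < T \<Longrightarrow> i < n \<Longrightarrow> j < n \<Longrightarrow> M t $$ (i, j) \<ge> 0"
    and "\<And>t i j. t < T \<Longrightarrow> i < n \<Longrightarrow> j < n \<Longrightarrow> A t $$ (i, j) = 0 \<Longrightarrow> M t $$ (i, j) = 0"
  shows "M \<in> primal_domain n T A"
  unfolding primal_domain_def less_eq_mat_def supp_mat_def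
  using assms by fastforce

text \<open>Where \<open>x j > 0\<close>, put \<open>z = r * q j / x j\<close> with \<open>r\<close>
  the total of \<open>x\<close>; the compensated term \<open>?g j\<close> is
  \<open>x j * (z - 1 - ln z)\<close>, nonnegative and zero only at \<open>z = 1\<close>. The
  compensations add up to \<open>r - r * sum q J \<ge> 0\<close>, so substochastic \<open>q\<close>
  only helps.\<close>

lemma gibbs_inequality:
  fixes x q :: "'a \<Rightarrow> real"
  assumes "finite J" and x: "\<And>j. j \<in> J \<Longrightarrow> x j \<ge> 0" and q: "\<And>j. j \<in> J \<Longrightarrow> q j \<ge> 0"
    and supp: "\<And>j. j \<in> J \<Longrightarrow> q j = 0 \<Longrightarrow> x j = 0" and q1: "sum q J \<le> 1"
  shows "(\<Sum>j\<in>J. x j * ln (x j / (sum x J * q j))) \<ge> 0"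
    and "(\<Sum>j\<in>J. x j * ln (x j / (sum x J * q j))) = 0 \<Longrightarrow> j \<in> J \<Longrightarrow> x j = sum x J * q j"
proof -
  let ?r = "sum x J"
  let ?g = "\<lambda>j. x j * ln (x j / (?r * q j)) - (x j - ?r * q j)"
  have r0: "?r \<ge> 0" using x by (rule sum_nonneg)
  have g: "?g j \<ge> 0" "?g j = 0 \<Longrightarrow> x j = ?r * q j" if j: "j \<in> J" for j
  proof -
    have both: "?g j \<ge> 0 \<and> (?g j = 0 \<longrightarrow> x j = ?r * q j)"
    proof (cases "x j = 0")
      case True
      have "?r * q j \<ge> 0" using r0 q[OF j] by (rule mult_nonneg_nonneg)
      then show ?thesis unfolding True by simp
    next
      case False
      then have xj: "x j > 0" using x[OF j] by simp
      have qj: "q j > 0" using False supp[OF j] q[OF j] by fastforce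
      have "x j \<le> ?r" using member_le_sum[OF j, of x] x assms(1) by auto
      then have r: "?r > 0" using xj by simp
      define z where "z = ?r * q j / x j"
      have z: "z > 0" unfolding z_def using xj qj r by simp
      have "ln (x j / (?r * q j)) = - ln z"
        unfolding z_def using xj qj r by (simp add: ln_div)
      then have eq: "?g j = x j * (z - 1 - ln z)"
        unfolding z_def using xj by (simp add: algebra_simps)
      have "z - 1 - ln z \<ge> 0" using ln_le_minus_one[OF z] by simp
      moreover have "z = 1" if "z - 1 - ln z = 0" using ln_eq_minus_one[OF z] that by simp
      ultimately show ?thesis unfolding eq using xj r qj by (auto simp: z_def)
    qed
    show "?g j \<ge> 0" using both by (rule conjunct1)
    show "?g j = 0 \<Longrightarrow> x j = ?r * q j" using both by (rule conjunct2[THEN mp])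
  qed
  have "(\<Sum>j\<in>J. ?g j) = (\<Sum>j\<in>J. x j * ln (x j / (?r * q j))) - (?r - ?r * sum q J)"
    by (simp add: sum_subtractf sum_distrib_left)
  moreover have "?r * sum q J \<le> ?r" using mult_left_mono[OF q1 r0] by simp
  ultimately have ge: "(\<Sum>j\<in>J. ?g j) \<le> (\<Sum>j\<in>J. x j * ln (x j / (?r * q j)))" by linarith
  have nonneg: "(\<Sum>j\<in>J. ?g j) \<ge> 0" by (rule sum_nonneg) (rule g)
  show "(\<Sum>j\<in>J. x j * ln (x j / (?r * q j))) \<ge> 0" using ge nonneg by linarith
  show "x j = ?r * q j" if "(\<Sum>j\<in>J. x j * ln (x j / (?r * q j))) = 0" "j \<in> J"
  proof -
    have "(\<Sum>j\<in>J. ?g j) = 0" using ge nonneg that by linarith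
    then have "?g j = 0" using sum_nonneg_eq_0_iff[OF assms(1), of ?g] g(1) that(2) by blast
    then show ?thesis using g(2) that(2) by blast
  qed
qed

text \<open>The multipliers \<open>\<nu>\<^sub>t\<close>, extended by \<open>\<nu>\<^sub>0 = 0\<close> and \<open>\<nu>\<^sub>T = C\<^sup>T \<lambda>\<^sub>T\<close> so that the conservation and
  terminal terms of the Lagrangian take the same form at every time.\<close>
definition potential ::
  "nat \<Rightarrow> nat \<Rightarrow> real mat \<Rightarrow> (nat \<Rightarrow> real vec) \<Rightarrow> (nat \<Rightarrow> real vec) \<Rightarrow> nat \<Rightarrow> real vec" where
  "potential n T C lam \<nu> t = (if t = 0 then 0\<^sub>v n else if t = T then C\<^sup>T *\<^sub>v lam T else \<nu> t)"

text \<open>With \<open>w\<^sub>t\<close> the exponential of the potential, this is the logarithm of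
  the factor that turns \<open>A\<^sub>t\<close> into \<open>diag (u\<^sub>t / w\<^sub>t) A\<^sub>t
  diag w\<^sub>t\<^sub>+\<^sub>1\<close> at entry \<open>(i, j)\<close>.\<close>

definition log_tilt ::
  "nat \<Rightarrow> nat \<Rightarrow> real mat \<Rightarrow> (nat \<Rightarrow> real vec) \<Rightarrow> (nat \<Rightarrow> real vec) \<Rightarrow> nat \<Rightarrow> nat \<Rightarrow> nat \<Rightarrow> real" where
  "log_tilt n T C lam \<nu> t i j = (C\<^sup>T *\<^sub>v lam t) $ i
     - potential n T C lam \<nu> t $ i + potential n T C lam \<nu> (Suc t) $ j"

lemma sum_mult_ones:
  assumes "M \<in> carrier_mat n n"
  shows "(\<Sum>i<n. \<Sum>j<n. M $$ (i, j) * x $ i) = x \<bullet> (M *\<^sub>v ones_vec n)"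
proof -
  have "x \<bullet> (M *\<^sub>v ones_vec n) = (\<Sum>i<n. x $ i * (M *\<^sub>v ones_vec n) $ i)"
    using assms by (simp add: scalar_prod_def atLeast0LessThan)
  also have "\<dots> = (\<Sum>i<n. x $ i * (\<Sum>j<n. M $$ (i, j)))"
    using assms by (intro sum.cong refl arg_cong2[where f = "(*)"] mult_ones_index) auto
  finally show ?thesis by (simp add: sum_distrib_left mult.commute)
qed

lemma sum_transpose_mult_ones:
  assumes "M \<in> carrier_mat n n"
  shows "(\<Sum>i<n. \<Sum>j<n. M $$ (i, j) * x $ j) = x \<bullet> (M\<^sup>T *\<^sub>v ones_vec n)"
proof -
  have "x \<bullet> (M\<^sup>T *\<^sub>v ones_vec n) = (\<Sum>j<n. x $ j * (M\<^sup>T *\<^sub>v ones_vec n) $ j)"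
    using assms by (simp add: scalar_prod_def atLeast0LessThan)
  also have "\<dots> = (\<Sum>j<n. x $ j * (\<Sum>i<n. M $$ (i, j)))"
    using assms by (intro sum.cong refl arg_cong2[where f = "(*)"] transpose_mult_ones_index) auto
  also have "\<dots> = (\<Sum>j<n. \<Sum>i<n. M $$ (i, j) * x $ j)" by (simp add: sum_distrib_left mult.commute)
  also have "\<dots> = (\<Sum>i<n. \<Sum>j<n. M $$ (i, j) * x $ j)" by (rule sum.swap)
  finally show ?thesis ..
qed

section \<open>The Lagrangian as a sum of row excesses\<close>

locale flow_problem =
  fixes n k T :: nat and A :: "nat \<Rightarrow> real mat" and C :: "real mat" and \<rho> :: "nat \<Rightarrow> real vec"
  assumes T: "T \<ge> 1" and A: "\<And>t. t < T \<Longrightarrow> row_stochastic n (A t)"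
    and C: "C \<in> carrier_mat k n" and \<rho>: "\<And>t. t \<le> T \<Longrightarrow> \<rho> t \<in> carrier_vec k"
begin

abbreviation "tilt \<equiv> log_tilt n T C"
abbreviation "pot \<equiv> potential n T C"
abbreviation multipliers :: "(nat \<Rightarrow> real vec) set" where "multipliers \<equiv> {..T} \<rightarrow> carrier_vec k"
abbreviation potentials :: "(nat \<Rightarrow> real vec) set" where "potentials \<equiv> {1..<T} \<rightarrow> carrier_vec n"
abbreviation "rsum M t i \<equiv> \<Sum>j<n. M t $$ (i, j)"

lemma CT: "lam \<in> multipliers \<Longrightarrow> t \<le> T \<Longrightarrow> C\<^sup>T *\<^sub>v lam t \<in> carrier_vec n"
  using C by (intro mult_mat_vec_carrier[of _ n k]) auto

lemma pot_carrier: "lam \<in> multipliers \<Longrightarrow> \<nu> \<in> potentials \<Longrightarrow> t \<le> T \<Longrightarrow> pot lam \<nu> t \<in> carrier_vec n"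
  using CT unfolding potential_def by auto

text \<open>Summation by parts in time. The potential at \<open>t\<close> meets the row sums of
  \<open>M t\<close> and the column sums of \<open>M (t - 1)\<close>, which together give the
  conservation residual; the value 0 at time 0 removes the first term, and the value at
  \<open>T\<close> produces the terminal one.\<close>

lemma multiplier_identity:
  assumes M: "\<And>t. t < T \<Longrightarrow> M t \<in> carrier_mat n n"
    and lam: "lam \<in> multipliers" and \<nu>: "\<nu> \<in> potentials"
  shows "(\<Sum>t<T. \<Sum>i<n. \<Sum>j<n. M t $$ (i, j) * tilt lam \<nu> t i j)
    = (\<Sum>t<T. lam t \<bullet> (C *\<^sub>v (M t *\<^sub>v ones_vec n)))
      + lam T \<bullet> (C *\<^sub>v ((M (T - 1))\<^sup>T *\<^sub>v ones_vec n))
      - (\<Sum>t\<in>{1..<T}. \<nu> t \<bullet> (M t *\<^sub>v ones_vec n - (M (t - 1))\<^sup>T *\<^sub>v ones_vec n))"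
proof -
  let ?R = "\<lambda>t. M t *\<^sub>v ones_vec n" and ?S = "\<lambda>t. (M t)\<^sup>T *\<^sub>v ones_vec n"
  obtain T' where T': "T = Suc T'" using T by (cases T) auto
  have R: "?R t \<in> carrier_vec n" if "t < T" for t
    by (rule mult_mat_vec_carrier[of _ n n]) (use M that in auto)
  have S: "?S t \<in> carrier_vec n" if "t < T" for t
    by (rule mult_mat_vec_carrier[of _ n n]) (use M that in auto)
  have adj: "(C\<^sup>T *\<^sub>v lam t) \<bullet> x = lam t \<bullet> (C *\<^sub>v x)" if "t \<le> T" "x \<in> carrier_vec n" for t x
    by (rule transpose_vec_mult_scalar[OF C]) (use lam that in auto)
  have "(\<Sum>i<n. \<Sum>j<n. M t $$ (i, j) * tilt lam \<nu> t i j)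
      = lam t \<bullet> (C *\<^sub>v ?R t) - pot lam \<nu> t \<bullet> ?R t + pot lam \<nu> (Suc t) \<bullet> ?S t" if t: "t < T" for t
  proof -
    have "(\<Sum>i<n. \<Sum>j<n. M t $$ (i, j) * tilt lam \<nu> t i j)
       = (\<Sum>i<n. \<Sum>j<n. M t $$ (i, j) * (C\<^sup>T *\<^sub>v lam t) $ i)
       - (\<Sum>i<n. \<Sum>j<n. M t $$ (i, j) * pot lam \<nu> t $ i)
       + (\<Sum>i<n. \<Sum>j<n. M t $$ (i, j) * pot lam \<nu> (Suc t) $ j)"
      unfolding log_tilt_def by (simp add: distrib_left right_diff_distrib sum.distrib sum_subtractf)
    then show ?thesis
      unfolding sum_mult_ones[OF M[OF t]] sum_transpose_mult_ones[OF M[OF t]]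
      using adj[of t, OF _ R[OF t]] t by simp
  qed
  then have "(\<Sum>t<T. \<Sum>i<n. \<Sum>j<n. M t $$ (i, j) * tilt lam \<nu> t i j)
     = (\<Sum>t<T. lam t \<bullet> (C *\<^sub>v ?R t)) - (\<Sum>t<T. pot lam \<nu> t \<bullet> ?R t) + (\<Sum>t<T. pot lam \<nu> (Suc t) \<bullet> ?S t)"
    by (simp add: sum.distrib sum_subtractf)
  moreover have "(\<Sum>t<T. pot lam \<nu> t \<bullet> ?R t) = (\<Sum>t\<in>{1..<T}. \<nu> t \<bullet> ?R t)"
  proof -
    have "(\<Sum>t<T. pot lam \<nu> t \<bullet> ?R t) = pot lam \<nu> 0 \<bullet> ?R 0 + (\<Sum>t<T'. pot lam \<nu> (Suc t) \<bullet> ?R (Suc t))"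
      unfolding T' by (rule sum.lessThan_Suc_shift)
    also have "pot lam \<nu> 0 \<bullet> ?R 0 = 0" using R[of 0] T unfolding potential_def by simp
    also have "(\<Sum>t<T'. pot lam \<nu> (Suc t) \<bullet> ?R (Suc t)) = (\<Sum>t<T'. \<nu> (Suc t) \<bullet> ?R (Suc t))"
      unfolding potential_def T' by (intro sum.cong) auto
    also have "\<dots> = (\<Sum>t\<in>{1..<T}. \<nu> t \<bullet> ?R t)"
      unfolding T' One_nat_def atLeastLessThanSuc_atLeastAtMost
      by (rule sum.atLeast1_atMost_eq[symmetric])
    finally show ?thesis by simp
  qed
  moreover have "(\<Sum>t<T. pot lam \<nu> (Suc t) \<bullet> ?S t)
      = (\<Sum>t\<in>{1..<T}. \<nu> t \<bullet> ?S (t - 1)) + lam T \<bullet> (C *\<^sub>v ?S (T - 1))"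
  proof -
    have "(\<Sum>t<T. pot lam \<nu> (Suc t) \<bullet> ?S t) = (\<Sum>t<T'. pot lam \<nu> (Suc t) \<bullet> ?S t) + pot lam \<nu> T \<bullet> ?S (T - 1)"
      unfolding T' by simp
    also have "pot lam \<nu> T \<bullet> ?S (T - 1) = lam T \<bullet> (C *\<^sub>v ?S (T - 1))"
      using adj[of T, OF _ S[of "T - 1"]] T unfolding potential_def by simp
    also have "(\<Sum>t<T'. pot lam \<nu> (Suc t) \<bullet> ?S t) = (\<Sum>t<T'. \<nu> (Suc t) \<bullet> ?S (Suc t - 1))"
      unfolding potential_def T' by (intro sum.cong) auto
    also have "\<dots> = (\<Sum>t\<in>{1..<T}. \<nu> t \<bullet> ?S (t - 1))"
      unfolding T' One_nat_def atLeastLessThanSuc_atLeastAtMost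
      by (rule sum.atLeast1_atMost_eq[symmetric])
    finally show ?thesis .
  qed
  moreover have "(\<Sum>t\<in>{1..<T}. \<nu> t \<bullet> (?R t - ?S (t - 1)))
      = (\<Sum>t\<in>{1..<T}. \<nu> t \<bullet> ?R t) - (\<Sum>t\<in>{1..<T}. \<nu> t \<bullet> ?S (t - 1))"
    unfolding sum_subtractf[symmetric]
    by (intro sum.cong refl scalar_prod_minus_distrib[of _ n]) (use R S \<nu> in auto)
  ultimately show ?thesis by simp
qed

text \<open>The linear parts of the divergence cancel in each row: a row of \<open>A t\<close> sums
  to 1, so both have total \<open>rsum M t i\<close>.\<close>

lemma primal_objective_eq:
  assumes M: "M \<in> primal_domain n T A"
  shows "primal_objective n T A M =
    (\<Sum>t<T. \<Sum>i<n. \<Sum>j<n. M t $$ (i, j) * ln (M t $$ (i, j) / (rsum M t i * A t $$ (i, j))))"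
  unfolding primal_objective_def
proof (rule sum.cong[OF refl])
  fix t assume "t \<in> {..<T}"
  then have t: "t < T" by simp
  note At = row_stochasticD[OF A[OF t]] and Mt = primal_domainD[OF M t]
  let ?f = "\<lambda>i j. M t $$ (i, j) * ln (M t $$ (i, j) / (rsum M t i * A t $$ (i, j)))"
  have v: "M t *\<^sub>v ones_vec n \<in> carrier_vec n"
    by (rule mult_mat_vec_carrier[of _ n n]) (use Mt in auto)
  have "kl_div (M t) (diag (M t *\<^sub>v ones_vec n) * A t)
      = (\<Sum>i<n. \<Sum>j<n. ?f i j - M t $$ (i, j) + rsum M t i * A t $$ (i, j))"
    unfolding kl_div_def using Mt(1) mult_diag_left_index[OF At(1) v] mult_ones_index[OF Mt(1)]
    by (intro sum.cong) auto
  also have "\<dots> = (\<Sum>i<n. \<Sum>j<n. ?f i j)"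
  proof (rule sum.cong[OF refl])
    fix i assume "i \<in> {..<n}"
    then have "(\<Sum>j<n. rsum M t i * A t $$ (i, j)) = rsum M t i"
      unfolding sum_distrib_left[symmetric] using At(3) by simp
    then show "(\<Sum>j<n. ?f i j - M t $$ (i, j) + rsum M t i * A t $$ (i, j)) = (\<Sum>j<n. ?f i j)"
      by (simp add: sum.distrib sum_subtractf)
  qed
  finally show "kl_div (M t) (diag (M t *\<^sub>v ones_vec n) * A t) = (\<Sum>i<n. \<Sum>j<n. ?f i j)" .
qed

text \<open>The relative entropy of a row with respect to its sum times the tilted kernel, without
  linear terms; it is homogeneous of degree 1 in the row.\<close>

definition excess :: "(nat \<Rightarrow> real mat) \<Rightarrow> (nat \<Rightarrow> real vec) \<Rightarrow> (nat \<Rightarrow> real vec) \<Rightarrow> nat \<Rightarrow> nat \<Rightarrow> real" where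
  "excess M lam \<nu> t i = (\<Sum>j<n. M t $$ (i, j) *
     ln (M t $$ (i, j) / (rsum M t i * (A t $$ (i, j) * exp (tilt lam \<nu> t i j)))))"

lemma rsum_pos:
  assumes "M \<in> primal_domain n T A" and "t < T" "i < n" "j < n" and "M t $$ (i, j) \<noteq> 0"
  shows "rsum M t i > 0"
proof -
  note Mt = primal_domainD[OF assms(1,2)]
  have "M t $$ (i, j) \<le> rsum M t i"
    using Mt(2) assms by (intro member_le_sum) auto
  then show ?thesis using Mt(2)[of i j] assms by auto
qed

text \<open>On nonzero entries of \<open>M\<close> the kernel and the row sum are positive, so the
  logarithm of the tilt splits off. Its pairing with \<open>M\<close> collects all multiplier terms
  except \<open>\<lambda>\<^sub>t \<bullet> \<rho>\<^sub>t\<close>.\<close>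

lemma lagrangian_eq:
  assumes M: "M \<in> primal_domain n T A" and lam: "lam \<in> multipliers" and \<nu>: "\<nu> \<in> potentials"
  shows "lagrangian n T A C \<rho> M lam \<nu> =
    dual_objective T \<rho> lam + (\<Sum>t<T. \<Sum>i<n. excess M lam \<nu> t i)"
proof -
  let ?f = "\<lambda>t i j. M t $$ (i, j) * ln (M t $$ (i, j) / (rsum M t i * A t $$ (i, j)))"
  let ?R = "\<lambda>t. M t *\<^sub>v ones_vec n" and ?S = "\<lambda>t. (M t)\<^sup>T *\<^sub>v ones_vec n"
  have M': "M t \<in> carrier_mat n n" if "t < T" for t using primal_domainD[OF M that] by simp
  have R: "C *\<^sub>v ?R t \<in> carrier_vec k" if "t < T" for t
    by (intro mult_mat_vec_carrier[of _ k n] mult_mat_vec_carrier[of _ n n]) (use M' C that in auto)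
  have S: "C *\<^sub>v ?S t \<in> carrier_vec k" if "t < T" for t
    by (intro mult_mat_vec_carrier[of _ k n] mult_mat_vec_carrier[of _ n n]) (use M' C that in auto)
  have "excess M lam \<nu> t i = (\<Sum>j<n. ?f t i j - M t $$ (i, j) * tilt lam \<nu> t i j)"
    if t: "t < T" and i: "i < n" for t i
    unfolding excess_def
  proof (rule sum.cong[OF refl])
    fix j assume "j \<in> {..<n}"
    then have j: "j < n" by simp
    show "M t $$ (i, j) * ln (M t $$ (i, j) / (rsum M t i * (A t $$ (i, j) * exp (tilt lam \<nu> t i j))))
       = ?f t i j - M t $$ (i, j) * tilt lam \<nu> t i j"
    proof (cases "M t $$ (i, j) = 0")
      case False
      then have m: "M t $$ (i, j) > 0" using primal_domainD(2)[OF M t i j] by simp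
      have a: "A t $$ (i, j) > 0"
        using False primal_domainD(3)[OF M t i j] row_stochasticD(2)[OF A[OF t] i j] by fastforce
      have "M t $$ (i, j) / (rsum M t i * (A t $$ (i, j) * exp (tilt lam \<nu> t i j)))
          = M t $$ (i, j) / (rsum M t i * A t $$ (i, j)) / exp (tilt lam \<nu> t i j)" by simp
      also have "ln \<dots> = ln (M t $$ (i, j) / (rsum M t i * A t $$ (i, j))) - tilt lam \<nu> t i j"
        using m a rsum_pos[OF M t i j False] by (subst ln_div) auto
      finally show ?thesis by (simp add: right_diff_distrib)
    qed simp
  qed
  then have "(\<Sum>t<T. \<Sum>i<n. excess M lam \<nu> t i)
      = primal_objective n T A M - (\<Sum>t<T. \<Sum>i<n. \<Sum>j<n. M t $$ (i, j) * tilt lam \<nu> t i j)"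
    unfolding primal_objective_eq[OF M] by (simp add: sum_subtractf)
  moreover have "(\<Sum>t<T. lam t \<bullet> (\<rho> t - C *\<^sub>v ?R t)) = (\<Sum>t<T. lam t \<bullet> \<rho> t) - (\<Sum>t<T. lam t \<bullet> (C *\<^sub>v ?R t))"
    unfolding sum_subtractf[symmetric]
    by (intro sum.cong refl scalar_prod_minus_distrib[of _ k]) (use R \<rho> lam in auto)
  moreover have "lam T \<bullet> (\<rho> T - C *\<^sub>v ?S (T - 1)) = lam T \<bullet> \<rho> T - lam T \<bullet> (C *\<^sub>v ?S (T - 1))"
    by (intro scalar_prod_minus_distrib[of _ k]) (use S \<rho> lam T in auto)
  moreover have "dual_objective T \<rho> lam = (\<Sum>t<T. lam t \<bullet> \<rho> t) + lam T \<bullet> \<rho> T"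
    unfolding dual_objective_def lessThan_Suc_atMost[symmetric] by simp
  moreover note multiplier_identity[of M, OF M' lam \<nu>]
  ultimately show ?thesis unfolding lagrangian_def by linarith
qed

text \<open>The infimum of the Lagrangian over \<open>M\<close> is finite iff the tilted kernel \<open>A\<^sub>t exp (tilt)\<close> is substochastic, i.e. iff
  all its row masses are at most 1.\<close>
definition mass :: "(nat \<Rightarrow> real vec) \<Rightarrow> (nat \<Rightarrow> real vec) \<Rightarrow> nat \<Rightarrow> nat \<Rightarrow> real" where
  "mass lam \<nu> t i = (\<Sum>j<n. A t $$ (i, j) * exp (tilt lam \<nu> t i j))"

lemma excess_nonneg:
  assumes M: "M \<in> primal_domain n T A" and t: "t < T" and i: "i < n" and "mass lam \<nu> t i \<le> 1"
  shows "excess M lam \<nu> t i \<ge> 0"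
    and "excess M lam \<nu> t i = 0 \<Longrightarrow> j < n \<Longrightarrow>
      M t $$ (i, j) = rsum M t i * (A t $$ (i, j) * exp (tilt lam \<nu> t i j))"
proof -
  note gibbs = gibbs_inequality[of "{..<n}" "\<lambda>j. M t $$ (i, j)" "\<lambda>j. A t $$ (i, j) * exp (tilt lam \<nu> t i j)"]
  show "excess M lam \<nu> t i \<ge> 0" unfolding excess_def
    by (rule gibbs(1)) (use assms primal_domainD[OF M t] row_stochasticD[OF A[OF t]] in \<open>auto simp: mass_def\<close>)
  show "M t $$ (i, j) = rsum M t i * (A t $$ (i, j) * exp (tilt lam \<nu> t i j))"
    if "excess M lam \<nu> t i = 0" "j < n"
    by (rule gibbs(2)) (use that assms primal_domainD[OF M t] row_stochasticD[OF A[OF t]]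
      in \<open>auto simp: mass_def excess_def\<close>)
qed

lemma lagrangian_ge:
  assumes "M \<in> primal_domain n T A" "lam \<in> multipliers" "\<nu> \<in> potentials"
    and "\<And>t i. t < T \<Longrightarrow> i < n \<Longrightarrow> mass lam \<nu> t i \<le> 1"
  shows "lagrangian n T A C \<rho> M lam \<nu> \<ge> dual_objective T \<rho> lam"
proof -
  have "(\<Sum>t<T. \<Sum>i<n. excess M lam \<nu> t i) \<ge> 0"
    by (intro sum_nonneg excess_nonneg(1)[OF assms(1)] assms(4)) auto
  then show ?thesis unfolding lagrangian_eq[OF assms(1-3)] by simp
qed

lemma zero_primal_domain: "(\<lambda>_. 0\<^sub>m n n) \<in> primal_domain n T A"
  by (rule primal_domainI) (use row_stochasticD[OF A] in auto)

lemma lagrangian_zero: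
  assumes "lam \<in> multipliers" "\<nu> \<in> potentials"
  shows "lagrangian n T A C \<rho> (\<lambda>_. 0\<^sub>m n n) lam \<nu> = dual_objective T \<rho> lam"
  unfolding lagrangian_eq[OF zero_primal_domain assms] excess_def by simp

text \<open>Fill only the offending row, proportionally to its tilted kernel. With row sum
  \<open>c\<close> its excess is \<open>- c * ln Z\<close>, where \<open>Z > 1\<close> is the mass,
  and all other rows contribute 0.\<close>

lemma lagrangian_unbounded:
  assumes lam: "lam \<in> multipliers" and \<nu>: "\<nu> \<in> potentials"
    and t0: "t0 < T" and i0: "i0 < n" and gt: "mass lam \<nu> t0 i0 > 1"
  shows "\<exists>M\<in>primal_domain n T A. lagrangian n T A C \<rho> M lam \<nu> \<le> B"
proof -
  let ?Z = "mass lam \<nu> t0 i0"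
  let ?q = "\<lambda>j. A t0 $$ (i0, j) * exp (tilt lam \<nu> t0 i0 j)"
  \<comment> \<open>Chosen so that \<open>c * ln Z\<close> is the required drop plus
    \<open>ln Z\<close>; the summand 1 also makes \<open>c\<close> positive.\<close>
  define c where "c = \<bar>dual_objective T \<rho> lam - B\<bar> / ln ?Z + 1"
  have lnZ: "ln ?Z > 0" using gt by simp
  have c: "c > 0" unfolding c_def using lnZ by (intro add_nonneg_pos divide_nonneg_pos) auto
  define M where "M t = mat n n (\<lambda>(i, j). if t = t0 \<and> i = i0 then c * ?q j / ?Z else 0)" for t
  have q: "?q j \<ge> 0" if "j < n" for j using row_stochasticD(2)[OF A[OF t0] i0 that] by simp
  have M: "M \<in> primal_domain n T A"
    by (rule primal_domainI) (use row_stochasticD[OF A] q c gt in \<open>auto simp: M_def\<close>)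
  have rs: "rsum M t0 i0 = c"
  proof -
    have "rsum M t0 i0 = (\<Sum>j<n. c / ?Z * ?q j)"
      using i0 by (intro sum.cong) (auto simp: M_def)
    also have "\<dots> = c / ?Z * ?Z" unfolding sum_distrib_left[symmetric] mass_def ..
    finally show ?thesis using gt by simp
  qed
  have "excess M lam \<nu> t i = (if t = t0 then if i = i0 then - c * ln ?Z else 0 else 0)"
    if "t < T" "i < n" for t i
  proof (cases "t = t0 \<and> i = i0")
    case True
    have "excess M lam \<nu> t0 i0 = (\<Sum>j<n. - c / ?Z * ln ?Z * ?q j)"
      unfolding excess_def rs
    proof (rule sum.cong[OF refl])
      fix j assume "j \<in> {..<n}"
      then have Mj: "M t0 $$ (i0, j) = c * ?q j / ?Z" using i0 by (simp add: M_def)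
      show "M t0 $$ (i0, j) * ln (M t0 $$ (i0, j) / (c * ?q j)) = - c / ?Z * ln ?Z * ?q j"
      proof (cases "?q j = 0")
        case False
        then have "M t0 $$ (i0, j) / (c * ?q j) = inverse ?Z"
          unfolding Mj using c gt by (simp add: divide_simps)
        then show ?thesis unfolding Mj using gt by (simp add: ln_inverse)
      qed (simp add: Mj)
    qed
    also have "\<dots> = - c / ?Z * ln ?Z * ?Z" unfolding sum_distrib_left[symmetric] mass_def ..
    finally show ?thesis using True gt by simp
  next
    case False
    then show ?thesis unfolding excess_def using that by (auto simp: M_def)
  qed
  then have "(\<Sum>t<T. \<Sum>i<n. excess M lam \<nu> t i)
      = (\<Sum>t<T. \<Sum>i<n. if t = t0 then if i = i0 then - c * ln ?Z else 0 else 0)"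
    by simp
  also have "\<dots> = (\<Sum>t<T. if t = t0 then \<Sum>i<n. if i = i0 then - c * ln ?Z else 0 else 0)"
    by (intro sum.cong) auto
  also have "\<dots> = - c * ln ?Z" using t0 i0 by simp
  also have "\<dots> \<le> B - dual_objective T \<rho> lam"
  proof -
    have "c * ln ?Z = \<bar>dual_objective T \<rho> lam - B\<bar> + ln ?Z"
      unfolding c_def using lnZ by (simp add: field_simps)
    then show ?thesis using lnZ by linarith
  qed
  finally show ?thesis
    using lagrangian_eq[OF M lam \<nu>] M by (intro bexI[of _ M]) auto
qed

section \<open>The backward recursion and the dual function\<close>

definition tail :: "(nat \<Rightarrow> real vec) \<Rightarrow> nat \<Rightarrow> real vec" where
  "tail lam t = foldr (\<lambda>t v. diag (scaling C lam t) *\<^sub>v (A t *\<^sub>v v)) [t..<T] (scaling C lam T)"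

lemma scaling_carrier: "lam \<in> multipliers \<Longrightarrow> t \<le> T \<Longrightarrow> scaling C lam t \<in> carrier_vec n"
  using CT unfolding scaling_def by simp

lemma scaling_index:
  "lam \<in> multipliers \<Longrightarrow> t \<le> T \<Longrightarrow> i < n \<Longrightarrow> scaling C lam t $ i = exp ((C\<^sup>T *\<^sub>v lam t) $ i)"
  using CT[of lam t] C unfolding scaling_def by simp

lemma tail_T: "tail lam T = scaling C lam T"
  unfolding tail_def by simp

lemma tail_step: "t < T \<Longrightarrow> tail lam t = diag (scaling C lam t) *\<^sub>v (A t *\<^sub>v tail lam (Suc t))"
  unfolding tail_def by (simp add: upt_conv_Cons)

lemma tail_carrier: "tail lam t \<in> carrier_vec n" if "lam \<in> multipliers" "t \<le> T"
  using that(2)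
proof (induction t rule: inc_induct)
  case base
  then show ?case using scaling_carrier[OF that(1)] by (simp add: tail_T)
next
  case (step t)
  then show ?case
    unfolding tail_step[OF step.hyps(2)]
    using diag_carrier[OF scaling_carrier[OF that(1)]] row_stochasticD(1)[OF A]
    by (intro mult_mat_vec_carrier[of _ n n]) auto
qed

lemma tail_index:
  assumes "lam \<in> multipliers" "t < T" "i < n"
  shows "tail lam t $ i = exp ((C\<^sup>T *\<^sub>v lam t) $ i) * (\<Sum>j<n. A t $$ (i, j) * tail lam (Suc t) $ j)"
proof -
  have At: "A t \<in> carrier_mat n n" using row_stochasticD(1)[OF A[OF assms(2)]] .
  have c: "tail lam (Suc t) \<in> carrier_vec n" using tail_carrier[OF assms(1)] assms by simp
  have "A t *\<^sub>v tail lam (Suc t) \<in> carrier_vec n" using At c by simp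
  then have "tail lam t $ i = scaling C lam t $ i * (A t *\<^sub>v tail lam (Suc t)) $ i"
    unfolding tail_step[OF assms(2)]
    using mult_diag_vec_index[of "scaling C lam t" n "A t *\<^sub>v tail lam (Suc t)" i]
      scaling_carrier[OF assms(1), of t] assms(2,3) by fastforce
  also have "(A t *\<^sub>v tail lam (Suc t)) $ i = (\<Sum>j<n. A t $$ (i, j) * tail lam (Suc t) $ j)"
    using At c assms by (simp add: scalar_prod_def atLeast0LessThan)
  finally show ?thesis using scaling_index[OF assms(1)] assms by simp
qed

text \<open>A row of \<open>A t\<close> sums to 1 and so has a nonzero entry; positivity then
  propagates backwards from the exponential at \<open>T\<close>.\<close>

lemma tail_pos: "tail lam t $ i > 0" if "lam \<in> multipliers" "t \<le> T" "i < n"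
  using that(2,3)
proof (induction t arbitrary: i rule: inc_induct)
  case base
  then show ?case using scaling_index[OF that(1)] by (simp add: tail_T)
next
  case (step t)
  note At = row_stochasticD[OF A[OF step.hyps(2)]]
  have nonneg: "A t $$ (i, j) * tail lam (Suc t) $ j \<ge> 0" if "j < n" for j
    by (intro mult_nonneg_nonneg At(2) step.prems that less_imp_le[OF step.IH])
  have "(\<Sum>j<n. A t $$ (i, j) * tail lam (Suc t) $ j) \<noteq> 0"
  proof
    assume "(\<Sum>j<n. A t $$ (i, j) * tail lam (Suc t) $ j) = 0"
    then have "\<forall>j<n. A t $$ (i, j) * tail lam (Suc t) $ j = 0"
      using nonneg by (subst (asm) sum_nonneg_eq_0_iff) auto
    then have "\<forall>j<n. A t $$ (i, j) = 0" using step.IH by fastforce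
    then show False using At(3)[OF step.prems] by simp
  qed
  moreover have "(\<Sum>j<n. A t $$ (i, j) * tail lam (Suc t) $ j) \<ge> 0"
    by (rule sum_nonneg) (use nonneg in auto)
  ultimately show ?case unfolding tail_index[OF that(1) step.hyps(2) step.prems] by simp
qed

lemma dual_constraint_iff:
  assumes "lam \<in> multipliers"
  shows "dual_constraint n T A C lam \<longleftrightarrow> (\<forall>i<n. tail lam 0 $ i \<le> 1)"
  using tail_carrier[OF assms, of 0]
  unfolding dual_constraint_def scaled_product_def tail_def less_eq_vec_def ones_vec_def by auto

definition log_tail :: "(nat \<Rightarrow> real vec) \<Rightarrow> nat \<Rightarrow> real vec" where
  "log_tail lam t = map_vec ln (tail lam t)"

lemma log_tail_potentials: "lam \<in> multipliers \<Longrightarrow> log_tail lam \<in> potentials"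
  using tail_carrier unfolding log_tail_def by auto

text \<open>At time 0 the potential is 0 and replaces the recursion's own value; this mismatch is
  what the constraint of (D) controls. At \<open>T\<close> both agree.\<close>

lemma exp_pot_log_tail:
  assumes "lam \<in> multipliers" "t \<le> T" "i < n"
  shows "exp (pot lam (log_tail lam) t $ i) = (if t = 0 then 1 else tail lam t $ i)"
  using assms tail_carrier[OF assms(1,2)] tail_pos[OF assms] scaling_index[OF assms(1)]
  unfolding potential_def log_tail_def by (auto simp: tail_T)

lemma exp_tilt:
  "exp (tilt lam \<nu> t i j) = exp ((C\<^sup>T *\<^sub>v lam t) $ i) / exp (pot lam \<nu> t $ i) * exp (pot lam \<nu> (Suc t) $ j)"
  unfolding log_tilt_def by (simp add: exp_add exp_diff)

lemma mass_eq:
  "mass lam \<nu> t i = exp ((C\<^sup>T *\<^sub>v lam t) $ i) * (\<Sum>j<n. A t $$ (i, j) * exp (pot lam \<nu> (Suc t) $ j))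
     / exp (pot lam \<nu> t $ i)"
  unfolding mass_def exp_tilt by (simp add: sum_distrib_left sum_divide_distrib mult_ac)

text \<open>For \<open>t > 0\<close> the recursion makes the mass exactly 1; at \<open>t = 0\<close>
  the mass is \<open>tail lam 0 $ i\<close>.\<close>

lemma mass_log_tail:
  assumes lam: "lam \<in> multipliers" and "dual_constraint n T A C lam" and t: "t < T" and i: "i < n"
  shows "mass lam (log_tail lam) t i \<le> 1"
proof -
  have "mass lam (log_tail lam) t i = tail lam t $ i / (if t = 0 then 1 else tail lam t $ i)"
    unfolding mass_eq tail_index[OF lam t i] using exp_pot_log_tail[OF lam] t i
    by (simp add: tail_index[OF lam t i])
  then show ?thesis using assms dual_constraint_iff[OF lam] tail_pos[OF lam _ i, of t] by auto
qed

text \<open>Masses at most 1 make the exponentials of the potentials a supersolution of the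
  recursion, so they dominate \<open>tail\<close> by backward induction, and at time 0 they equal
  1.\<close>

lemma dual_constraintI:
  assumes lam: "lam \<in> multipliers" and mass: "\<And>t i. t < T \<Longrightarrow> i < n \<Longrightarrow> mass lam \<nu> t i \<le> 1"
  shows "dual_constraint n T A C lam"
proof -
  have "tail lam t $ i \<le> exp (pot lam \<nu> t $ i)" if "t \<le> T" "i < n" for t i
    using that
  proof (induction t arbitrary: i rule: inc_induct)
    case base
    then show ?case using scaling_index[OF lam] T by (simp add: tail_T potential_def)
  next
    case (step t)
    have "tail lam t $ i \<le> exp ((C\<^sup>T *\<^sub>v lam t) $ i) * (\<Sum>j<n. A t $$ (i, j) * exp (pot lam \<nu> (Suc t) $ j))"
      unfolding tail_index[OF lam step.hyps(2) step.prems]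
      using step.IH row_stochasticD(2)[OF A[OF step.hyps(2)] step.prems]
      by (intro mult_left_mono sum_mono) auto
    also have "\<dots> \<le> exp (pot lam \<nu> t $ i)"
      using mass[OF step.hyps(2) step.prems] unfolding mass_eq by (simp add: field_simps)
    finally show ?case .
  qed
  from this[of 0] show ?thesis unfolding dual_constraint_iff[OF lam] by (simp add: potential_def)
qed

text \<open>The zero flow bounds every infimum by the dual objective, and \<open>log_tail\<close>
  attains this bound under the constraint. Without the constraint every \<open>\<nu>\<close> leaves
  some row of mass above 1, and the infimum is minus infinity.\<close>

lemma dual_function:
  assumes lam: "lam \<in> multipliers"
  shows "(SUP \<nu> \<in> potentials. INF M \<in> primal_domain n T A. ereal (lagrangian n T A C \<rho> M lam \<nu>))
     = (if dual_constraint n T A C lam then ereal (dual_objective T \<rho> lam) else - \<infinity>)"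
proof (cases "dual_constraint n T A C lam")
  case True
  have "(INF M \<in> primal_domain n T A. ereal (lagrangian n T A C \<rho> M lam \<nu>)) \<le> ereal (dual_objective T \<rho> lam)"
    if "\<nu> \<in> potentials" for \<nu>
    by (rule INF_lower2[OF zero_primal_domain]) (simp add: lagrangian_zero[OF lam that])
  moreover have "ereal (dual_objective T \<rho> lam)
      \<le> (INF M \<in> primal_domain n T A. ereal (lagrangian n T A C \<rho> M lam (log_tail lam)))"
    by (rule INF_greatest)
      (use lagrangian_ge[OF _ lam log_tail_potentials[OF lam] mass_log_tail[OF lam True]] in simp)
  ultimately show ?thesis using True log_tail_potentials[OF lam]
    by (auto intro!: antisym SUP_least intro: SUP_upper2)
next
  case False
  have "(INF M \<in> primal_domain n T A. ereal (lagrangian n T A C \<rho> M lam \<nu>)) = - \<infinity>"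
    if \<nu>: "\<nu> \<in> potentials" for \<nu>
  proof -
    obtain t i where ti: "t < T" "i < n" "mass lam \<nu> t i > 1"
      using False dual_constraintI[OF lam, of \<nu>] by force
    show ?thesis
    proof (rule ereal_bot)
      fix B
      obtain M where "M \<in> primal_domain n T A" "lagrangian n T A C \<rho> M lam \<nu> \<le> B"
        using lagrangian_unbounded[OF lam \<nu> ti] by blast
      then show "(INF M \<in> primal_domain n T A. ereal (lagrangian n T A C \<rho> M lam \<nu>)) \<le> ereal B"
        by (intro INF_lower2) auto
    qed
  qed
  note unbounded = this
  have "(SUP \<nu> \<in> potentials. INF M \<in> primal_domain n T A. ereal (lagrangian n T A C \<rho> M lam \<nu>))
      = (SUP \<nu> \<in> potentials. - \<infinity>)"
    by (rule arg_cong[where f = Sup], rule image_cong[OF refl], rule unbounded)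
  also have "\<dots> = - \<infinity>"
    using log_tail_potentials[OF lam] by (intro cSUP_const) (metis empty_iff)
  finally show ?thesis using False by (simp only: if_False)
qed

section \<open>Weak duality and its equality case\<close>

lemma lagrangian_feasible:
  assumes "primal_feasible n T A C \<rho> M" "lam \<in> multipliers" "\<nu> \<in> potentials"
  shows "lagrangian n T A C \<rho> M lam \<nu> = primal_objective n T A M"
proof -
  have z: "lam t \<bullet> (\<rho> t - \<rho> t) = 0" if "t \<le> T" for t
  proof -
    have "lam t \<in> carrier_vec k" using assms(2) that by auto
    then show ?thesis unfolding minus_cancel_vec[OF \<rho>[OF that]] by simp
  qed
  have \<nu>0: "\<nu> t \<bullet> (M t *\<^sub>v ones_vec n - M t *\<^sub>v ones_vec n) = 0" if "t \<in> {1..<T}" for t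
  proof -
    have "M t *\<^sub>v ones_vec n \<in> carrier_vec n"
      using assms(1) that unfolding primal_feasible_def primal_domain_def
      by (intro mult_mat_vec_carrier[of _ n n]) auto
    moreover have "\<nu> t \<in> carrier_vec n" using assms(3) that by blast
    ultimately show ?thesis by simp
  qed
  have "(\<Sum>t\<in>{1..<T}. \<nu> t \<bullet> (M t *\<^sub>v ones_vec n - (M (t - 1))\<^sup>T *\<^sub>v ones_vec n)) = 0"
    using assms(1) \<nu>0 unfolding primal_feasible_def by (intro sum.neutral) metis
  then show ?thesis
    using assms(1) z unfolding lagrangian_def primal_feasible_def by simp
qed

lemma weak_duality:
  assumes "primal_feasible n T A C \<rho> M" "lam \<in> multipliers" "dual_constraint n T A C lam"
  shows "dual_objective T \<rho> lam \<le> primal_objective n T A M"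
  using lagrangian_ge[OF _ assms(2) log_tail_potentials[OF assms(2)] mass_log_tail[OF assms(2,3)], of M]
    lagrangian_feasible[OF assms(1,2) log_tail_potentials[OF assms(2)]] assms(1)
  unfolding primal_feasible_def by simp

text \<open>Without a gap, the nonnegative excesses have a sum of at most 0; all of them vanish, and
  the equality case of Gibbs' inequality gives the entries.\<close>

lemma tight_imp_scaling_form:
  assumes M: "primal_feasible n T A C \<rho> M" and lam: "lam \<in> multipliers"
    and dc: "dual_constraint n T A C lam"
    and tight: "primal_objective n T A M \<le> dual_objective T \<rho> lam"
    and t: "t < T" and i: "i < n" and j: "j < n"
  shows "M t $$ (i, j) = rsum M t i * (A t $$ (i, j) * exp (tilt lam (log_tail lam) t i j))"
proof -
  let ?e = "\<lambda>t i. excess M lam (log_tail lam) t i"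
  have Md: "M \<in> primal_domain n T A" using M unfolding primal_feasible_def by blast
  note ex = excess_nonneg[OF Md _ _ mass_log_tail[OF lam dc]]
  have "(\<Sum>t<T. \<Sum>i<n. ?e t i) \<le> 0"
    using lagrangian_eq[OF Md lam log_tail_potentials[OF lam]]
      lagrangian_feasible[OF M lam log_tail_potentials[OF lam]] tight by simp
  moreover have row: "(\<Sum>i<n. ?e t i) \<ge> 0" if "t < T" for t
    by (intro sum_nonneg ex(1)) (use that in auto)
  moreover have "(\<Sum>i<n. ?e t i) \<le> (\<Sum>t<T. \<Sum>i<n. ?e t i)"
    by (rule member_le_sum) (use row t in auto)
  moreover have "?e t i \<le> (\<Sum>i<n. ?e t i)"
    by (rule member_le_sum) (use ex(1) t i in auto)
  moreover have "?e t i \<ge> 0" using ex(1) t i by blast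
  ultimately have "?e t i = 0" by linarith
  then show ?thesis using ex(2) t i j by blast
qed

subsection \<open>Strong duality\<close>

lemma log_tilt_add:
  assumes "lam \<in> multipliers" "lam' \<in> multipliers" "\<nu> \<in> potentials" "\<nu>' \<in> potentials"
    and "t < T" "i < n" "j < n"
  shows "tilt (\<lambda>t. lam t + lam' t) (\<lambda>t. \<nu> t + \<nu>' t) t i j = tilt lam \<nu> t i j + tilt lam' \<nu>' t i j"
proof -
  have CTadd: "C\<^sup>T *\<^sub>v (lam t + lam' t) = C\<^sup>T *\<^sub>v lam t + C\<^sup>T *\<^sub>v lam' t" if "t \<le> T" for t
    by (rule mult_add_distrib_mat_vec[of _ n k]) (use C assms(1,2) that in auto)
  have "pot (\<lambda>t. lam t + lam' t) (\<lambda>t. \<nu> t + \<nu>' t) t = pot lam \<nu> t + pot lam' \<nu>' t" for t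
    unfolding potential_def using CTadd[of T] by auto
  then show ?thesis
    using CTadd[of t] CT[OF assms(2), of t] pot_carrier[OF assms(2,4), of t]
      pot_carrier[OF assms(2,4), of "Suc t"] assms(5-7) C
    unfolding log_tilt_def by simp
qed

lemma log_tilt_smult:
  assumes "lam \<in> multipliers" "\<nu> \<in> potentials" and "t < T" "i < n" "j < n"
  shows "tilt (\<lambda>t. c \<cdot>\<^sub>v lam t) (\<lambda>t. c \<cdot>\<^sub>v \<nu> t) t i j = c * tilt lam \<nu> t i j"
proof -
  have CTsm: "C\<^sup>T *\<^sub>v (c \<cdot>\<^sub>v lam t) = c \<cdot>\<^sub>v (C\<^sup>T *\<^sub>v lam t)" if "t \<le> T" for t
    by (rule mult_mat_vec[of _ n k]) (use C assms(1) that in auto)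
  have "pot (\<lambda>t. c \<cdot>\<^sub>v lam t) (\<lambda>t. c \<cdot>\<^sub>v \<nu> t) t = c \<cdot>\<^sub>v pot lam \<nu> t" for t
    unfolding potential_def using CTsm[of T] by auto
  then show ?thesis
    using CTsm[of t] CT[OF assms(1), of t] pot_carrier[OF assms(1,2), of t]
      pot_carrier[OF assms(1,2), of "Suc t"] assms(3-5) C
    unfolding log_tilt_def by (simp add: algebra_simps)
qed

definition support :: "(nat \<times> nat \<times> nat) set" where
  "support = {(t, i, j). t < T \<and> i < n \<and> j < n \<and> A t $$ (i, j) > 0}"

definition source :: "nat \<times> nat \<times> nat \<Rightarrow> nat \<times> nat" where
  "source = (\<lambda>(t, i, j). (t, i))"

text \<open>The cutoff outside the index range makes sums and multiples again exactly of this form;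
  linearity of the tilt is available only inside the range.\<close>

definition tilt_space :: "(nat \<times> nat \<times> nat \<Rightarrow> real) set" where
  "tilt_space = {\<lambda>(t, i, j). if t < T \<and> i < n \<and> j < n then tilt lam \<nu> t i j else 0 | lam \<nu>.
     lam \<in> multipliers \<and> \<nu> \<in> potentials}"

lemma source_eq: "source (t, i, j) = (t, i)"
  by (simp add: source_def)

lemma finite_support: "finite support"
  by (rule finite_subset[of _ "{..<T} \<times> {..<n} \<times> {..<n}"]) (auto simp: support_def)

lemma sum_support:
  assumes "\<And>t i j. t < T \<Longrightarrow> i < n \<Longrightarrow> j < n \<Longrightarrow> A t $$ (i, j) = 0 \<Longrightarrow> f (t, i, j) = 0"
  shows "(\<Sum>e\<in>support. f e) = (\<Sum>t<T. \<Sum>i<n. \<Sum>j<n. f (t, i, j))"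
proof -
  have "(\<Sum>e\<in>support. f e) = (\<Sum>e\<in>{..<T} \<times> {..<n} \<times> {..<n}. f e)"
  proof (rule sum.mono_neutral_left)
    show "\<forall>e\<in>{..<T} \<times> {..<n} \<times> {..<n} - support. f e = 0"
    proof
      fix e assume e: "e \<in> {..<T} \<times> {..<n} \<times> {..<n} - support"
      obtain t i j where tij: "e = (t, i, j)" by (cases e)
      then have "t < T" "i < n" "j < n" "\<not> A t $$ (i, j) > 0" using e by (auto simp: support_def)
      moreover from this have "A t $$ (i, j) = 0" using row_stochasticD(2)[OF A, of t i j] by linarith
      ultimately show "f e = 0" using assms tij by blast
    qed
  qed (auto simp: support_def)
  also have "\<dots> = (\<Sum>t<T. \<Sum>i<n. \<Sum>j<n. f (t, i, j))"
    unfolding sum.cartesian_product by (intro sum.cong) auto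
  finally show ?thesis .
qed

lemma fibre_sum_support:
  assumes "t < T" "i < n" and "\<And>j. j < n \<Longrightarrow> A t $$ (i, j) = 0 \<Longrightarrow> f (t, i, j) = 0"
  shows "fibre_sum support source f (t, i) = (\<Sum>j<n. f (t, i, j))"
proof -
  have fib: "{e \<in> support. source e = (t, i)} = Pair t ` Pair i ` {j. j < n \<and> A t $$ (i, j) > 0}"
    using assms unfolding support_def source_def by auto
  have "fibre_sum support source f (t, i) = (\<Sum>j | j < n \<and> A t $$ (i, j) > 0. f (t, i, j))"
    unfolding fibre_sum_def fib image_image by (subst sum.reindex) (auto simp: inj_on_def)
  also have "\<dots> = (\<Sum>j<n. f (t, i, j))"
  proof (rule sum.mono_neutral_left)
    show "\<forall>j\<in>{..<n} - {j. j < n \<and> A t $$ (i, j) > 0}. f (t, i, j) = 0"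
    proof
      fix j assume "j \<in> {..<n} - {j. j < n \<and> A t $$ (i, j) > 0}"
      then have "j < n" "\<not> A t $$ (i, j) > 0" by auto
      moreover from this have "A t $$ (i, j) = 0"
        using row_stochasticD(2)[OF A[OF assms(1)] assms(2), of j] by linarith
      ultimately show "f (t, i, j) = 0" using assms(3) by blast
    qed
  qed auto
  finally show ?thesis .
qed

text \<open>Every row sums to 1 and thus meets the support, so the fibres of \<open>source\<close>
  account for all row constraints.\<close>

lemma source_support: "r \<in> source ` support \<longleftrightarrow> fst r < T \<and> snd r < n"
proof
  assume r: "fst r < T \<and> snd r < n"
  obtain j where "j < n" "A (fst r) $$ (snd r, j) \<noteq> 0"
    using row_stochasticD(3)[OF A, of "fst r" "snd r"] r
    by (metis lessThan_iff sum.neutral zero_neq_one)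
  then have "(fst r, snd r, j) \<in> support"
    using row_stochasticD(2)[OF A, of "fst r" "snd r" j] r by (auto simp: support_def)
  then show "r \<in> source ` support" by (force simp: source_def)
qed (auto simp: source_def support_def)

lemma pointwise_subspace_tilt_space: "pointwise_subspace tilt_space"
  unfolding pointwise_subspace_def
proof (intro conjI ballI allI)
  have z: "(\<lambda>_. 0\<^sub>v k) \<in> multipliers" "(\<lambda>_. 0\<^sub>v n) \<in> potentials" by auto
  have sm: "0 \<cdot>\<^sub>v 0\<^sub>v l = (0\<^sub>v l :: real vec)" for l by (rule eq_vecI) auto
  have "(\<lambda>_. 0) = (\<lambda>(t, i, j). if t < T \<and> i < n \<and> j < n
      then tilt (\<lambda>_. 0\<^sub>v k) (\<lambda>_. 0\<^sub>v n) t i j else 0)"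
    using log_tilt_smult[OF z, of _ _ _ 0] by (auto simp: fun_eq_iff sm)
  then show "(\<lambda>_. 0) \<in> tilt_space" using z unfolding tilt_space_def by blast
next
  fix v w assume "v \<in> tilt_space" "w \<in> tilt_space"
  then obtain lam \<nu> lam' \<nu>' where
    v: "v = (\<lambda>(t, i, j). if t < T \<and> i < n \<and> j < n then tilt lam \<nu> t i j else 0)"
      "lam \<in> multipliers" "\<nu> \<in> potentials"
    and w: "w = (\<lambda>(t, i, j). if t < T \<and> i < n \<and> j < n then tilt lam' \<nu>' t i j else 0)"
      "lam' \<in> multipliers" "\<nu>' \<in> potentials"
    unfolding tilt_space_def by blast
  have "(\<lambda>t. lam t + lam' t) \<in> multipliers" "(\<lambda>t. \<nu> t + \<nu>' t) \<in> potentials"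
    by (intro Pi_I add_carrier_vec Pi_mem[OF v(2)] Pi_mem[OF w(2)] Pi_mem[OF v(3)] Pi_mem[OF w(3)];
        assumption)+
  moreover have "(\<lambda>e. v e + w e) = (\<lambda>(t, i, j). if t < T \<and> i < n \<and> j < n
      then tilt (\<lambda>t. lam t + lam' t) (\<lambda>t. \<nu> t + \<nu>' t) t i j else 0)"
    unfolding v(1) w(1) by (auto simp: fun_eq_iff log_tilt_add[OF v(2) w(2) v(3) w(3)])
  ultimately show "(\<lambda>e. v e + w e) \<in> tilt_space" unfolding tilt_space_def by blast
next
  fix c :: real and v assume "v \<in> tilt_space"
  then obtain lam \<nu> where
    v: "v = (\<lambda>(t, i, j). if t < T \<and> i < n \<and> j < n then tilt lam \<nu> t i j else 0)"
      "lam \<in> multipliers" "\<nu> \<in> potentials"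
    unfolding tilt_space_def by blast
  have "(\<lambda>t. c \<cdot>\<^sub>v lam t) \<in> multipliers" "(\<lambda>t. c \<cdot>\<^sub>v \<nu> t) \<in> potentials"
    using Pi_mem[OF v(2)] Pi_mem[OF v(3)] by (simp_all add: Pi_iff)
  moreover have "(\<lambda>e. c * v e) = (\<lambda>(t, i, j). if t < T \<and> i < n \<and> j < n
      then tilt (\<lambda>t. c \<cdot>\<^sub>v lam t) (\<lambda>t. c \<cdot>\<^sub>v \<nu> t) t i j else 0)"
    unfolding v(1) by (auto simp: fun_eq_iff log_tilt_smult[OF v(2,3)])
  ultimately show "(\<lambda>e. c * v e) \<in> tilt_space" unfolding tilt_space_def by blast
qed

text \<open>For feasible \<open>M\<close> the conservation residuals vanish in the multiplier
  identity. The dual objective thereby becomes a linear form in the tilt alone.\<close>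

lemma feasible_pairing:
  assumes M: "primal_feasible n T A C \<rho> M" and lam: "lam \<in> multipliers" and \<nu>: "\<nu> \<in> potentials"
  shows "(\<Sum>t<T. \<Sum>i<n. \<Sum>j<n. M t $$ (i, j) * tilt lam \<nu> t i j) = dual_objective T \<rho> lam"
proof -
  have Md: "M \<in> primal_domain n T A" using M unfolding primal_feasible_def by blast
  have Mc: "M t \<in> carrier_mat n n" if "t < T" for t using primal_domainD(1)[OF Md that] .
  have flow: "M t *\<^sub>v ones_vec n - (M (t - 1))\<^sup>T *\<^sub>v ones_vec n = 0\<^sub>v n" if "t \<in> {1..<T}" for t
  proof -
    have "M t *\<^sub>v ones_vec n = (M (t - 1))\<^sup>T *\<^sub>v ones_vec n"
      using M that unfolding primal_feasible_def by blast
    moreover have "M t *\<^sub>v ones_vec n \<in> carrier_vec n"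
      by (rule mult_mat_vec_carrier[of _ n n]) (use Mc that in auto)
    ultimately show ?thesis by simp
  qed
  have "(\<Sum>t\<in>{1..<T}. \<nu> t \<bullet> (M t *\<^sub>v ones_vec n - (M (t - 1))\<^sup>T *\<^sub>v ones_vec n)) = 0"
  proof (intro sum.neutral ballI)
    fix t assume "t \<in> {1..<T}"
    moreover from this have "\<nu> t \<in> carrier_vec n" using \<nu> by blast
    ultimately show "\<nu> t \<bullet> (M t *\<^sub>v ones_vec n - (M (t - 1))\<^sup>T *\<^sub>v ones_vec n) = 0"
      using flow by simp
  qed
  moreover have "(\<Sum>t<T. lam t \<bullet> (C *\<^sub>v (M t *\<^sub>v ones_vec n))) = (\<Sum>t<T. lam t \<bullet> \<rho> t)"
    using M unfolding primal_feasible_def by simp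
  moreover have "C *\<^sub>v ((M (T - 1))\<^sup>T *\<^sub>v ones_vec n) = \<rho> T"
    using M unfolding primal_feasible_def by blast
  moreover have "dual_objective T \<rho> lam = (\<Sum>t<T. lam t \<bullet> \<rho> t) + lam T \<bullet> \<rho> T"
    unfolding dual_objective_def lessThan_Suc_atMost[symmetric] by simp
  ultimately show ?thesis using multiplier_identity[of M, OF Mc lam \<nu>] by simp
qed

text \<open>The converse: testing with unit vectors at one time recovers the constraints one
  coordinate at a time, the observations from \<open>\<lambda>\<close> and the conservation law from
  \<open>\<nu>\<close>.\<close>

lemma feasible_from_pairing:
  assumes Md: "M \<in> primal_domain n T A"
    and pairing: "\<And>lam \<nu>. lam \<in> multipliers \<Longrightarrow> \<nu> \<in> potentials \<Longrightarrow>
      (\<Sum>t<T. \<Sum>i<n. \<Sum>j<n. M t $$ (i, j) * tilt lam \<nu> t i j) = dual_objective T \<rho> lam"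
  shows "primal_feasible n T A C \<rho> M"
proof -
  let ?R = "\<lambda>t. M t *\<^sub>v ones_vec n" and ?S = "\<lambda>t. (M t)\<^sup>T *\<^sub>v ones_vec n"
  have Mc: "M t \<in> carrier_mat n n" if "t < T" for t using primal_domainD(1)[OF Md that] .
  have R: "?R t \<in> carrier_vec n" if "t < T" for t
    by (rule mult_mat_vec_carrier[of _ n n]) (use Mc that in auto)
  have S: "?S t \<in> carrier_vec n" if "t < T" for t
    by (rule mult_mat_vec_carrier[of _ n n]) (use Mc that in auto)
  have CR: "C *\<^sub>v ?R t \<in> carrier_vec k" if "t < T" for t
    by (rule mult_mat_vec_carrier[OF C R[OF that]])
  have CS: "C *\<^sub>v ?S t \<in> carrier_vec k" if "t < T" for t
    by (rule mult_mat_vec_carrier[OF C S[OF that]])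
  have D: "?R t - ?S (t - 1) \<in> carrier_vec n" if "t \<in> {1..<T}" for t
  proof -
    have "t - 1 < T" "t < T" using that by auto
    then show ?thesis using R S by simp
  qed
  define lam1 where "lam1 t l = (\<lambda>s. if s = t then unit_vec k l else 0\<^sub>v k :: real vec)" for t l :: nat
  define nu1 where "nu1 t i = (\<lambda>s. if s = t then unit_vec n i else 0\<^sub>v n :: real vec)" for t i :: nat
  have lam1: "lam1 t l \<in> multipliers" for t l unfolding lam1_def by auto
  have nu1: "nu1 t i \<in> potentials" for t i unfolding nu1_def by auto
  have lam1_dot: "lam1 t l s \<bullet> x = (if s = t then x $ l else 0)"
    if "x \<in> carrier_vec k" "l < k" for t l s x
    using that unfolding lam1_def by simp
  have nu1_dot: "nu1 t l s \<bullet> x = (if s = t then x $ l else 0)"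
    if "x \<in> carrier_vec n" "l < n" for t l s x
    using that unfolding nu1_def by simp
  have eq: "(\<Sum>t<T. lam t \<bullet> (C *\<^sub>v ?R t)) + lam T \<bullet> (C *\<^sub>v ?S (T - 1))
      - (\<Sum>t\<in>{1..<T}. \<nu> t \<bullet> (?R t - ?S (t - 1))) = (\<Sum>t<T. lam t \<bullet> \<rho> t) + lam T \<bullet> \<rho> T"
    if "lam \<in> multipliers" "\<nu> \<in> potentials" for lam \<nu>
    using pairing[OF that] multiplier_identity[of M, OF Mc that]
    unfolding dual_objective_def lessThan_Suc_atMost[symmetric] by simp
  have zero_nu: "(\<Sum>t\<in>{1..<T}. 0\<^sub>v n \<bullet> (?R t - ?S (t - 1))) = 0"
    using D by (intro sum.neutral) auto
  have zero_lam: "(\<Sum>t<T. 0\<^sub>v k \<bullet> (C *\<^sub>v ?R t)) = 0" "0\<^sub>v k \<bullet> (C *\<^sub>v ?S (T - 1)) = 0"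
    "(\<Sum>t<T. 0\<^sub>v k \<bullet> \<rho> t) = 0" "0\<^sub>v k \<bullet> \<rho> T = 0"
    using CR CS[of "T - 1"] \<rho> T by (auto intro: sum.neutral)
  have single: "(\<Sum>s<T. lam1 t l s \<bullet> x s) = (if t < T then x t $ l else 0)"
    if "\<And>s. s < T \<Longrightarrow> x s \<in> carrier_vec k" "l < k" for t l x
  proof -
    have "(\<Sum>s<T. lam1 t l s \<bullet> x s) = (\<Sum>s<T. if s = t then x s $ l else 0)"
      by (intro sum.cong refl) (use lam1_dot that in auto)
    then show ?thesis by simp
  qed
  have lam_eq: "(if t < T then (C *\<^sub>v ?R t) $ l else 0) + (if t = T then (C *\<^sub>v ?S (T - 1)) $ l else 0)
      = (if t < T then \<rho> t $ l else 0) + (if t = T then \<rho> T $ l else 0)" if l: "l < k" for t l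
  proof -
    have "(\<Sum>s<T. lam1 t l s \<bullet> (C *\<^sub>v ?R s)) = (if t < T then (C *\<^sub>v ?R t) $ l else 0)"
      by (rule single) (use CR l in auto)
    moreover have "(\<Sum>s<T. lam1 t l s \<bullet> \<rho> s) = (if t < T then \<rho> t $ l else 0)"
      by (rule single) (use \<rho> l in auto)
    moreover have "lam1 t l T \<bullet> (C *\<^sub>v ?S (T - 1)) = (if t = T then (C *\<^sub>v ?S (T - 1)) $ l else 0)"
      using lam1_dot[OF CS[of "T - 1"] l, of t T] T by auto
    moreover have "lam1 t l T \<bullet> \<rho> T = (if t = T then \<rho> T $ l else 0)"
      using lam1_dot[OF \<rho>[of T] l, of t T] by auto
    moreover have "(\<lambda>_. 0\<^sub>v n) \<in> potentials" by auto
    ultimately show ?thesis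
      using eq[OF lam1[of t l], of "\<lambda>_. 0\<^sub>v n"] zero_nu by simp
  qed
  have "C *\<^sub>v ?R t = \<rho> t" if "t < T" for t
    using lam_eq[of _ t] CR[OF that] \<rho>[of t] C that by (intro eq_vecI) auto
  moreover have "C *\<^sub>v ?S (T - 1) = \<rho> T"
    using lam_eq[of _ T] CS[of "T - 1"] \<rho>[of T] C T by (intro eq_vecI) auto
  moreover have "?R t = ?S (t - 1)" if t: "t \<in> {1..<T}" for t
  proof -
    have "t < T" "t - 1 < T" using t by auto
    note Rt = carrier_vecD[OF R[OF this(1)]] and St = carrier_vecD[OF S[OF this(2)]]
    show ?thesis
    proof (rule eq_vecI)
      fix i assume "i < dim_vec (?S (t - 1))"
      then have i: "i < n" unfolding St .
      have "(\<Sum>s\<in>{1..<T}. nu1 t i s \<bullet> (?R s - ?S (s - 1)))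
          = (\<Sum>s\<in>{1..<T}. if s = t then (?R s - ?S (s - 1)) $ i else 0)"
        by (intro sum.cong refl) (use nu1_dot[OF D i] in auto)
      also have "\<dots> = (?R t - ?S (t - 1)) $ i" using t by simp
      finally have "(?R t - ?S (t - 1)) $ i = 0"
        using eq[of "\<lambda>_. 0\<^sub>v k", OF _ nu1[of t i]] zero_lam by simp
      then show "?R t $ i = ?S (t - 1) $ i" using Rt St i by simp
    qed (simp only: Rt St)
  qed
  ultimately show ?thesis using Md unfolding primal_feasible_def by blast
qed

lemma strong_duality:
  assumes feas: "primal_feasible n T A C \<rho> M"
    and pos: "\<And>t i j. t < T \<Longrightarrow> i < n \<Longrightarrow> j < n \<Longrightarrow> A t $$ (i, j) > 0 \<Longrightarrow> M t $$ (i, j) > 0"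
  shows "\<exists>lam\<in>multipliers. dual_constraint n T A C lam \<and>
    (\<forall>\<epsilon>>0. \<exists>M. primal_feasible n T A C \<rho> M \<and>
      primal_objective n T A M \<le> dual_objective T \<rho> lam + \<epsilon>)"
proof -
  define a where "a = (\<lambda>(t, i, j). A t $$ (i, j))"
  define m where "m = (\<lambda>(t, i, j). M t $$ (i, j))"
  have Md: "M \<in> primal_domain n T A" using feas unfolding primal_feasible_def by blast
  interpret exponential_program support source a m tilt_space
  proof
    fix r assume "r \<in> source ` support"
    then have r: "fst r < T" "snd r < n" using source_support by auto
    have "fibre_sum support source a (fst r, snd r) = (\<Sum>j<n. a (fst r, snd r, j))"
      by (rule fibre_sum_support[OF r]) (simp add: a_def)
    then show "fibre_sum support source a r = 1"
      using row_stochasticD(3)[OF A[OF r(1)] r(2)] by (simp add: a_def)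
  qed (use finite_support pointwise_subspace_tilt_space pos in \<open>auto simp: a_def m_def support_def\<close>)
  \<comment> \<open>The fact \<open>strong_duality\<close> used here is the one of the interpreted
    exponential program.\<close>
  obtain s where "s \<in> tilt_space" and Zs: "\<And>r. r \<in> source ` support \<Longrightarrow> Z s r \<le> 1"
    and approx: "\<And>\<epsilon>. \<epsilon> > 0 \<Longrightarrow> \<exists>f. (\<forall>e\<in>support. f e \<ge> 0) \<and>
      (\<forall>v\<in>tilt_space. (\<Sum>e\<in>support. f e * v e) = lin v) \<and>
      (\<Sum>e\<in>support. f e * ln (f e / (fibre_sum support source f (source e) * a e))) \<le> lin s + \<epsilon>"
    using strong_duality by blast
  then obtain lam \<nu> where s: "s = (\<lambda>(t, i, j). if t < T \<and> i < n \<and> j < n then tilt lam \<nu> t i j else 0)"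
    and lam: "lam \<in> multipliers" and \<nu>: "\<nu> \<in> potentials"
    unfolding tilt_space_def by blast
  have lin_eq: "lin (\<lambda>(t, i, j). if t < T \<and> i < n \<and> j < n then tilt lam \<nu> t i j else 0)
      = dual_objective T \<rho> lam"
    if "lam \<in> multipliers" "\<nu> \<in> potentials" for lam \<nu>
    unfolding feasible_pairing[OF feas that, symmetric]
    by (subst sum_support) (use primal_domainD(3)[OF Md] in \<open>auto simp: m_def intro!: sum.cong\<close>)
  have "mass lam \<nu> t i \<le> 1" if "t < T" "i < n" for t i
  proof -
    have "Z s (t, i) = (\<Sum>j<n. a (t, i, j) * exp (s (t, i, j)))"
      by (rule fibre_sum_support[OF that]) (simp add: a_def)
    then have "Z s (t, i) = mass lam \<nu> t i" using that by (simp add: mass_def a_def s)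
    then show ?thesis using Zs[of "(t, i)"] source_support that by auto
  qed
  then have "dual_constraint n T A C lam" by (rule dual_constraintI[OF lam])
  moreover have "\<exists>M. primal_feasible n T A C \<rho> M \<and>
      primal_objective n T A M \<le> dual_objective T \<rho> lam + \<epsilon>" if "\<epsilon> > 0" for \<epsilon>
  proof -
    obtain f where f0: "\<And>e. e \<in> support \<Longrightarrow> f e \<ge> 0"
      and flin: "\<And>v. v \<in> tilt_space \<Longrightarrow> (\<Sum>e\<in>support. f e * v e) = lin v"
      and fval: "(\<Sum>e\<in>support. f e * ln (f e / (fibre_sum support source f (source e) * a e))) \<le> lin s + \<epsilon>"
      using approx[OF \<open>\<epsilon> > 0\<close>] by blast
    \<comment> \<open>Values of \<open>f\<close> off the support are arbitrary; they are replaced by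
      0 to stay in the primal domain.\<close>
    define N where "N t = mat n n (\<lambda>(i, j). if A t $$ (i, j) > 0 then f (t, i, j) else 0)" for t
    have Nd: "N \<in> primal_domain n T A"
      by (rule primal_domainI) (use f0 row_stochasticD(1)[OF A] in \<open>auto simp: N_def support_def\<close>)
    have Nf: "N t $$ (i, j) = f (t, i, j)" if "(t, i, j) \<in> support" for t i j
      using that by (auto simp: N_def support_def)
    have N0: "N t $$ (i, j) = 0" if "t < T" "i < n" "j < n" "A t $$ (i, j) = 0" for t i j
      using primal_domainD(3)[OF Nd] that by blast
    \<comment> \<open>Agrees with \<open>f\<close> on the support and vanishes where the kernel
      does, as passing between sums over the support and over all indices demands.\<close>
    define g where "g = (\<lambda>(t, i, j). N t $$ (i, j))"
    have g: "g e = f e" if "e \<in> support" for e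
      using that Nf by (cases e) (auto simp: g_def)
    have "primal_feasible n T A C \<rho> N"
    proof (rule feasible_from_pairing[OF Nd])
      fix lam \<nu> assume lam: "lam \<in> multipliers" and \<nu>: "\<nu> \<in> potentials"
      let ?v = "\<lambda>(t, i, j). if t < T \<and> i < n \<and> j < n then tilt lam \<nu> t i j else 0"
      have "(\<Sum>t<T. \<Sum>i<n. \<Sum>j<n. N t $$ (i, j) * tilt lam \<nu> t i j) = (\<Sum>e\<in>support. g e * ?v e)"
        by (subst sum_support) (use N0 in \<open>auto simp: g_def intro!: sum.cong\<close>)
      also have "\<dots> = (\<Sum>e\<in>support. f e * ?v e)" by (intro sum.cong) (auto simp: g)
      also have "\<dots> = lin ?v" by (rule flin) (use lam \<nu> in \<open>auto simp: tilt_space_def\<close>)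
      finally show "(\<Sum>t<T. \<Sum>i<n. \<Sum>j<n. N t $$ (i, j) * tilt lam \<nu> t i j) = dual_objective T \<rho> lam"
        unfolding lin_eq[OF lam \<nu>] .
    qed
    moreover have "primal_objective n T A N \<le> dual_objective T \<rho> lam + \<epsilon>"
    proof -
      have fib: "fibre_sum support source f (t, i) = rsum N t i" if "t < T" "i < n" for t i
      proof -
        have "fibre_sum support source f (t, i) = fibre_sum support source g (t, i)"
          unfolding fibre_sum_def by (intro sum.cong) (auto simp: g)
        also have "\<dots> = (\<Sum>j<n. g (t, i, j))"
          by (rule fibre_sum_support[OF that]) (use N0 that in \<open>auto simp: g_def\<close>)
        finally show ?thesis by (simp add: g_def)
      qed
      let ?h = "\<lambda>(t, i, j). N t $$ (i, j) * ln (N t $$ (i, j) / (rsum N t i * A t $$ (i, j)))"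
      have "primal_objective n T A N = (\<Sum>e\<in>support. ?h e)"
        unfolding primal_objective_eq[OF Nd] by (subst sum_support) (use N0 in auto)
      also have "\<dots> = (\<Sum>e\<in>support. f e * ln (f e / (fibre_sum support source f (source e) * a e)))"
      proof (rule sum.cong[OF refl])
        fix e assume e: "e \<in> support"
        obtain t i j where tij: "e = (t, i, j)" by (cases e)
        then have "t < T" "i < n" using e by (auto simp: support_def)
        then show "?h e = f e * ln (f e / (fibre_sum support source f (source e) * a e))"
          using Nf[of t i j] e fib[of t i] by (simp add: tij source_eq a_def)
      qed
      finally show ?thesis using fval lin_eq[OF lam \<nu>] s by simp
    qed
    ultimately show ?thesis by blast
  qed
  ultimately show ?thesis using lam by blast
qed

end

section \<open>Dual attainment and the form of the primal optima\<close>

theorem theorem1: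
  fixes n k T :: nat
    and A :: "nat \<Rightarrow> real mat"
    and \<pi> :: "nat list"
    and C :: "real mat"
    and \<rho> :: "nat \<Rightarrow> real vec"
  assumes "n \<ge> 1" and "T \<ge> 1"
    and "\<And>t. t < T \<Longrightarrow> row_stochastic n (A t)"
    and "distinct \<pi>" and "set \<pi> \<subseteq> {..<n}" and "length \<pi> = k"
    and "C = selection_mat n \<pi>"
    and "\<And>t. t \<le> T \<Longrightarrow> \<rho> t \<in> carrier_vec k"
    and "\<exists>M. primal_feasible n T A C \<rho> M \<and>
           (\<forall>t<T. \<forall>i<n. \<forall>j<n. A t $$ (i, j) > 0 \<longrightarrow> M t $$ (i, j) > 0)"
  shows "(\<forall>lam \<in> {..T} \<rightarrow> carrier_vec k.
           (SUP \<nu> \<in> {1..<T} \<rightarrow> carrier_vec n.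
              INF M \<in> primal_domain n T A. ereal (lagrangian n T A C \<rho> M lam \<nu>))
           = (if dual_constraint n T A C lam then ereal (\<Sum>t\<le>T. lam t \<bullet> \<rho> t) else - \<infinity>))
       \<and> (\<exists>lam. dual_optimal n k T A C \<rho> lam)
       \<and> (\<forall>lam. dual_optimal n k T A C \<rho> lam \<longrightarrow>
           (\<exists>w :: nat \<Rightarrow> real vec.
              (\<forall>t\<in>{1..<T}. w t \<in> carrier_vec n \<and> (\<forall>i<n. w t $ i > 0)) \<and>
              w 0 = ones_vec n \<and> w T = scaling C lam T \<and>
              (\<forall>M. primal_optimal n T A C \<rho> M \<longrightarrow>
                (\<forall>t<T. M t = diag (M t *\<^sub>v ones_vec n) * diag (scaling C lam t \<oslash> w t)
                              * A t * diag (w (t + 1))))))"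
proof -
  have C: "C \<in> carrier_mat k n"
    using assms(6,7) unfolding selection_mat_def mat_of_rows_def by auto
  interpret flow_problem n k T A C \<rho>
    by unfold_locales (use assms C in auto)
  obtain M0 where M0: "primal_feasible n T A C \<rho> M0"
      "\<And>t i j. t < T \<Longrightarrow> i < n \<Longrightarrow> j < n \<Longrightarrow> A t $$ (i, j) > 0 \<Longrightarrow> M0 t $$ (i, j) > 0"
    using assms(9) by blast
  obtain lam0 where lam0: "lam0 \<in> multipliers" "dual_constraint n T A C lam0"
    and approx: "\<And>\<epsilon>. \<epsilon> > 0 \<Longrightarrow> \<exists>M. primal_feasible n T A C \<rho> M \<and>
      primal_objective n T A M \<le> dual_objective T \<rho> lam0 + \<epsilon>"
    using strong_duality[OF M0] by blast
  have opt: "dual_optimal n k T A C \<rho> lam \<longleftrightarrow> lam \<in> multipliers \<and> dual_constraint n T A C lam \<and>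
    (\<forall>lam'. lam' \<in> multipliers \<and> dual_constraint n T A C lam' \<longrightarrow>
      dual_objective T \<rho> lam' \<le> dual_objective T \<rho> lam)" for lam
    unfolding dual_optimal_def is_arg_max_def by (auto simp: not_less)
  \<comment> \<open>Every dual value lies below every primal value, and primal values come
    arbitrarily close to the dual value of \<open>lam0\<close>.\<close>
  have dual: "dual_optimal n k T A C \<rho> lam0"
    unfolding opt
  proof (intro conjI allI impI lam0)
    fix lam assume lam: "lam \<in> multipliers \<and> dual_constraint n T A C lam"
    show "dual_objective T \<rho> lam \<le> dual_objective T \<rho> lam0"
      by (rule field_le_epsilon) (use approx weak_duality lam in \<open>meson order_trans\<close>)
  qed
  have scaling: "\<exists>w :: nat \<Rightarrow> real vec.
      (\<forall>t\<in>{1..<T}. w t \<in> carrier_vec n \<and> (\<forall>i<n. w t $ i > 0)) \<and>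
      w 0 = ones_vec n \<and> w T = scaling C lam T \<and>
      (\<forall>M. primal_optimal n T A C \<rho> M \<longrightarrow>
        (\<forall>t<T. M t = diag (M t *\<^sub>v ones_vec n) * diag (scaling C lam t \<oslash> w t)
                      * A t * diag (w (t + 1))))"
    if lam_opt: "dual_optimal n k T A C \<rho> lam" for lam
  proof -
    have lam: "lam \<in> multipliers" "dual_constraint n T A C lam"
      and le: "dual_objective T \<rho> lam0 \<le> dual_objective T \<rho> lam"
      using lam_opt lam0 unfolding opt by auto
    \<comment> \<open>The recursion vectors of the given maximizer, with the prescribed value at
      time 0; they do not depend on \<open>M\<close>.\<close>
    define w where "w t = (if t = 0 then ones_vec n else tail lam t)" for t
    have wc: "w t \<in> carrier_vec n" if "t \<le> T" for t
      using tail_carrier[OF lam(1) that] unfolding w_def by simp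
    have w_pot: "exp (pot lam (log_tail lam) t $ i) = w t $ i" if "t \<le> T" "i < n" for t i
      using exp_pot_log_tail[OF lam(1) that] that unfolding w_def by (simp add: ones_vec_def)
    have "M t = diag (M t *\<^sub>v ones_vec n) * diag (scaling C lam t \<oslash> w t) * A t * diag (w (t + 1))"
      if M: "primal_optimal n T A C \<rho> M" and t: "t < T" for M t
    proof -
      have feas: "primal_feasible n T A C \<rho> M"
        and min: "\<And>N. primal_feasible n T A C \<rho> N \<Longrightarrow> primal_objective n T A M \<le> primal_objective n T A N"
        using M unfolding primal_optimal_def is_arg_min_def by (auto simp: not_less)
      \<comment> \<open>An optimal \<open>M\<close> lies below all approximating feasible points, so
        there is no gap to \<open>lam0\<close>, nor to \<open>lam\<close>, whose dual value is at
        least as large.\<close>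
      have "primal_objective n T A M \<le> dual_objective T \<rho> lam0"
        by (rule field_le_epsilon) (use approx min in \<open>meson order_trans\<close>)
      then have tight: "primal_objective n T A M \<le> dual_objective T \<rho> lam" using le by simp
      have Mt: "M t \<in> carrier_mat n n"
        using feas t unfolding primal_feasible_def primal_domain_def by blast
      note At = row_stochasticD(1)[OF A[OF t]]
      let ?r = "M t *\<^sub>v ones_vec n" and ?u = "scaling C lam t \<oslash> w t"
      have r: "?r \<in> carrier_vec n" by (rule mult_mat_vec_carrier[OF Mt]) simp
      have uc: "scaling C lam t \<in> carrier_vec n" using scaling_carrier[OF lam(1)] t by simp
      then have u: "?u \<in> carrier_vec n" unfolding divide_vec_def by simp
      have ru: "diag ?r * diag ?u \<in> carrier_mat n n" using r u by (intro mult_carrier_mat[of _ n n]) auto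
      have rua: "diag ?r * diag ?u * A t \<in> carrier_mat n n" using ru At by (rule mult_carrier_mat)
      have w1: "w (t + 1) \<in> carrier_vec n" using wc t by simp
      have ua: "diag ?u * A t \<in> carrier_mat n n" using u At by (intro mult_carrier_mat[of _ n n]) auto
      have assoc: "diag ?r * diag ?u * A t = diag ?r * (diag ?u * A t)"
        by (rule assoc_mult_mat[of _ n n _ n _ n]) (use r u At in auto)
      have prod: "diag ?r * diag ?u * A t * diag (w (t + 1)) \<in> carrier_mat n n"
        using rua diag_carrier[OF w1] by (rule mult_carrier_mat)
      show ?thesis
      proof (rule eq_matI)
        fix i j
        assume "i < dim_row (diag ?r * diag ?u * A t * diag (w (t + 1)))"
          and "j < dim_col (diag ?r * diag ?u * A t * diag (w (t + 1)))"
        then have i: "i < n" and j: "j < n"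
          using carrier_matD[OF prod] by (simp_all only:)
        have "(diag ?r * diag ?u * A t * diag (w (t + 1))) $$ (i, j)
            = ?r $ i * (?u $ i * A t $$ (i, j)) * w (t + 1) $ j"
          unfolding mult_diag_right_index[OF rua w1 i j] unfolding assoc
            mult_diag_left_index[OF ua r i j] mult_diag_left_index[OF At u i j] ..
        also have "?r $ i = (\<Sum>j<n. M t $$ (i, j))" by (rule mult_ones_index[OF Mt i])
        also have "?u $ i = exp ((C\<^sup>T *\<^sub>v lam t) $ i) / w t $ i"
          using scaling_index[OF lam(1) _ i, of t] uc t i unfolding divide_vec_def by simp
        finally show "M t $$ (i, j) = (diag ?r * diag ?u * A t * diag (w (t + 1))) $$ (i, j)"
          using tight_imp_scaling_form[OF feas lam tight t i j] w_pot[of t i] w_pot[of "Suc t" j] t i j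
          unfolding exp_tilt by (simp add: mult_ac)
      qed (simp_all only: carrier_matD[OF prod] carrier_matD[OF Mt])
    qed
    moreover have "w T = scaling C lam T" using assms(2) unfolding w_def by (simp add: tail_T)
    moreover have "w 0 = ones_vec n" unfolding w_def by simp
    moreover have "\<forall>t\<in>{1..<T}. w t \<in> carrier_vec n \<and> (\<forall>i<n. w t $ i > 0)"
      using tail_carrier[OF lam(1)] tail_pos[OF lam(1)] unfolding w_def by simp
    ultimately show ?thesis by blast
  qed
  show ?thesis
    using dual_function dual scaling unfolding dual_objective_def by blast
qed

end
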